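(* Let $(X,\mu,C)$ be the continuous block model described in the context, and let $P_\varepsilon\in\Pi(\mu,\mu)$, $\varepsilon>0$, be its entropic minimisers. There does not exist a lower semicontinuous function $I_{\mathrm{amb}}:X\times X\to[0,\infty]$ such that $(P_\varepsilon)_{\varepsilon>0}$ satisfies a full large-deviation principle on $X\times X$ at speed $1/\varepsilon$ with rate function $I_{\mathrm{amb}}$.
   Context: Discrete label model. Fix real parameters $0<2a<\kappa<b$. For $n\ge1$ set $m_n:=\max\{2,\lfloor e^{\kappa n}\rfloor\}$, $L_n:=n^4$, $w_n:=\frac{1}{\zeta(3)}n^{-3}$. Let $X_{\mathrm d}:=\{(n,i):n\ge1,\ 0\le i\le m_n\}$ with the discrete metric, and $\mu^{\mathrm d}(\{(n,i)\}):=w_n/(m_n+1)$. Define $C^{\mathrm d}:X_{\mathrm d}\times X_{\mathrm d}\to[0,\infty)$ by $C^{\mathrm d}((n,i),(m,j))=0$ if $n=m$, $i=j$; $=a$ if $n=m$ and exactly one of $i,j$ equals $0$; $=b$ if $n=m$, $i\ne j$ and $i,j\in\{1,\dots,m_n\}$; $=L_n+L_m$ if $n\ne m$. Continuous block model. Let $M_1:=0$, $M_{n+1}:=M_n+3(m_n+1)$, $I_{n,i}:=[M_n+3i,\,M_n+3i+1]\subset\mathbb{R}$ for $n\ge1$, $0\le i\le m_n$, and $X:=\bigcup_{n\ge1}\bigcup_{i=0}^{m_n}I_{n,i}\subset\mathbb{R}$ with the Euclidean metric. Let $\lambda_{n,i}$ be Lebesgue measure restricted to $I_{n,i}$, and $\mu:=\sum_{n\ge1}\sum_{i=0}^{m_n}\frac{w_n}{m_n+1}\lambda_{n,i}$.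 The label map $\ell:X\to X_{\mathrm d}$ is $\ell(x)=(n,i)$ iff $x\in I_{n,i}$, and $C(x,y):=C^{\mathrm d}(\ell(x),\ell(y))$. $\Pi(\mu,\mu)$ is the set of Borel probability measures on $X\times X$ with both marginals $\mu$. $\mathrm{KL}(P\|Q)=\int\log(dP/dQ)\,dP$ if $P\ll Q$, $+\infty$ otherwise. The entropic minimiser $P_\varepsilon$ is the unique minimiser over $\Pi(\mu,\mu)$ of $P\mapsto\int C\,dP+\varepsilon\,\mathrm{KL}(P\|\mu\otimes\mu)$ (it exists and is unique for every $\varepsilon>0$). $(P_\varepsilon)$ satisfies a full large-deviation principle on $X\times X$ at speed $1/\varepsilon$ with rate $I_{\mathrm{amb}}$ if $I_{\mathrm{amb}}:X\times X\to[0,\infty]$ is lower semicontinuous, $\limsup_{\varepsilon\downarrow0}\varepsilon\log P_\varepsilon(\mathcal C)\le-\inf_{\mathcal C}I_{\mathrm{amb}}$ for every closed $\mathcal C\subset X\times X$, and $\liminf_{\varepsilon\downarrow0}\varepsilon\log P_\varepsilon(O)\ge-\inf_OI_{\mathrm{amb}}$ for every open $O\subset X\times X$. Conventions: $\log0=-\infty$, $\inf\emptyset=+\infty$. *)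

theory Defs
  imports "HOL-Probability.Probability"
begin

section \<open>Discrete label model\<close>

definition label_count :: "real \<Rightarrow> nat \<Rightarrow> nat" where
  "label_count \<kappa> n = max 2 (nat \<lfloor>exp (\<kappa> * real n)\<rfloor>)"

definition cross_cost :: "nat \<Rightarrow> real" where
  "cross_cost n = real n ^ 4"

definition zeta3 :: real where
  "zeta3 = (\<Sum>k. 1 / real (Suc k) ^ 3)"

definition weight :: "nat \<Rightarrow> real" where
  "weight n = (1 / zeta3) * (1 / real n ^ 3)"

definition labels :: "real \<Rightarrow> (nat \<times> nat) set" where
  "labels \<kappa> = {(n, i). 1 \<le> n \<and> i \<le> label_count \<kappa> n}"

text \<open>On labels the third branch is exactly the case of distinct indices, both at least 1.\<close>

fun label_cost :: "real \<Rightarrow> real \<Rightarrow> nat \<times> nat \<Rightarrow> nat \<times> nat \<Rightarrow> real" where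
  "label_cost a b (n, i) (m, j) =
     (if n = m then
        (if i = j then 0 else if (i = 0) \<noteq> (j = 0) then a else b)
      else cross_cost n + cross_cost m)"

section \<open>Continuous block model\<close>

text \<open>The value at index 0 is never used: blocks are indexed from 1.\<close>

fun block_start :: "real \<Rightarrow> nat \<Rightarrow> nat" where
  "block_start \<kappa> 0 = 0"
| "block_start \<kappa> (Suc 0) = 0"
| "block_start \<kappa> (Suc (Suc n)) =
     block_start \<kappa> (Suc n) + 3 * (label_count \<kappa> (Suc n) + 1)"

definition cell :: "real \<Rightarrow> nat \<Rightarrow> nat \<Rightarrow> real set" where
  "cell \<kappa> n i = {real (block_start \<kappa> n + 3 * i) .. real (block_start \<kappa> n + 3 * i) + 1}"

definition cell_space :: "real \<Rightarrow> real set" where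
  "cell_space \<kappa> = (\<Union>n\<in>{1..}. \<Union>i\<le>label_count \<kappa> n. cell \<kappa> n i)"

text \<open>The Borel measure \<open>\<mu>\<close> on the subspace \<^term>\<open>cell_space \<kappa>\<close>. The outer series runs over
  \<open>Suc n\<close> because blocks are indexed from 1; countable additivity, which makes
  \<^const>\<open>measure_of\<close> take the displayed values, is lemma \<open>emeasure_cell_measure\<close> below.\<close>

definition cell_measure_fun :: "real \<Rightarrow> real set \<Rightarrow> ennreal" where
  "cell_measure_fun \<kappa> A =
     (\<Sum>n. \<Sum>i\<le>label_count \<kappa> (Suc n).
        ennreal (weight (Suc n) / (real (label_count \<kappa> (Suc n)) + 1))
          * emeasure lborel (A \<inter> cell \<kappa> (Suc n) i))"

definition cell_measure :: "real \<Rightarrow> real measure" where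
  "cell_measure \<kappa> =
     measure_of (cell_space \<kappa>) (sets (restrict_space borel (cell_space \<kappa>))) (cell_measure_fun \<kappa>)"

text \<open>The cells are pairwise disjoint, so the label of a point of \<^term>\<open>cell_space \<kappa>\<close> is unique
  (lemma \<open>label_eq\<close>); outside that set the value is arbitrary and irrelevant.\<close>

definition label :: "real \<Rightarrow> real \<Rightarrow> nat \<times> nat" where
  "label \<kappa> x = (THE p. p \<in> labels \<kappa> \<and> x \<in> cell \<kappa> (fst p) (snd p))"

definition cost :: "real \<Rightarrow> real \<Rightarrow> real \<Rightarrow> real \<Rightarrow> real \<Rightarrow> real" where
  "cost a b \<kappa> x y = label_cost a b (label \<kappa> x) (label \<kappa> y)"

section \<open>Entropic optimal transport\<close>

definition couplings ::
    "'a::topological_space set \<Rightarrow> 'a measure \<Rightarrow> 'a measure \<Rightarrow> ('a \<times> 'a) measure set" where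
  "couplings S M N =
     {P. prob_space P \<and> sets P = sets (restrict_space borel (S \<times> S)) \<and>
         distr P M fst = M \<and> distr P N snd = N}"

text \<open>\<^const>\<open>KL_divergence\<close> takes the reference measure first and is a Bochner integral, hence 0
  when the integrand is not integrable. As the negative part of \<open>log (dP/dQ)\<close> is
  \<open>P\<close>-integrable for probability measures, the integral is then \<open>+\<infinity>\<close>.\<close>

definition KL :: "'a measure \<Rightarrow> 'a measure \<Rightarrow> ereal" where
  "KL P Q =
     (if absolutely_continuous Q P \<and> integrable P (entropy_density (exp 1) Q P)
      then ereal (KL_divergence (exp 1) Q P) else \<infinity>)"

definition entropic_cost ::
    "('a \<Rightarrow> 'a \<Rightarrow> real) \<Rightarrow> 'a measure \<Rightarrow> real \<Rightarrow> ('a \<times> 'a) measure \<Rightarrow> ereal" where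
  "entropic_cost c M \<epsilon> P =
     enn2ereal (\<integral>\<^sup>+ (x, y). ennreal (c x y) \<partial>P) + ereal \<epsilon> * KL P (M \<Otimes>\<^sub>M M)"

definition is_entropic_minimiser ::
    "'a::topological_space set \<Rightarrow> ('a \<Rightarrow> 'a \<Rightarrow> real) \<Rightarrow> 'a measure \<Rightarrow> real \<Rightarrow> ('a \<times> 'a) measure \<Rightarrow> bool"
  where
  "is_entropic_minimiser S c M \<epsilon> P \<longleftrightarrow>
     P \<in> couplings S M M \<and> (\<forall>Q\<in>couplings S M M. entropic_cost c M \<epsilon> P \<le> entropic_cost c M \<epsilon> Q)"

section \<open>Large deviations\<close>

definition elog :: "real \<Rightarrow> ereal" where
  "elog p = (if p = 0 then -\<infinity> else ereal (ln p))"

definition lower_semicontinuous_on :: "'a::topological_space set \<Rightarrow> ('a \<Rightarrow> ennreal) \<Rightarrow> bool" where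
  "lower_semicontinuous_on S f \<longleftrightarrow> (\<forall>c. closedin (top_of_set S) {x\<in>S. f x \<le> c})"

definition full_LDP ::
    "'a::topological_space set \<Rightarrow> (real \<Rightarrow> 'a measure) \<Rightarrow> ('a \<Rightarrow> ennreal) \<Rightarrow> bool" where
  "full_LDP S P I \<longleftrightarrow>
     lower_semicontinuous_on S I \<and>
     (\<forall>C. closedin (top_of_set S) C \<longrightarrow>
        Limsup (at_right 0) (\<lambda>\<epsilon>. ereal \<epsilon> * elog (measure (P \<epsilon>) C))
          \<le> - enn2ereal (INF z\<in>C. I z)) \<and>
     (\<forall>U. openin (top_of_set S) U \<longrightarrow>
        Liminf (at_right 0) (\<lambda>\<epsilon>. ereal \<epsilon> * elog (measure (P \<epsilon>) U))
          \<ge> - enn2ereal (INF z\<in>U. I z))"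

section \<open>Well-definedness of the block model\<close>

lemma block_start_step:
  assumes "1 \<le> n" "n < m"
  shows "block_start \<kappa> n + 3 * (label_count \<kappa> n + 1) \<le> block_start \<kappa> m"
  using assms(2,1)
proof (induction m)
  case (Suc m)
  then obtain m' where m: "m = Suc m'" by (cases m) auto
  show ?case
  proof (cases "n = m")
    case True
    then show ?thesis by (simp add: m)
  next
    case False
    with Suc show ?thesis by (simp add: m)
  qed
qed simp

lemma cell_unique:
  assumes "(n, i) \<in> labels \<kappa>" "(m, j) \<in> labels \<kappa>" "x \<in> cell \<kappa> n i" "x \<in> cell \<kappa> m j"
  shows "n = m \<and> i = j"
proof -
  have 1: "real (block_start \<kappa> n + 3 * i) < real (block_start \<kappa> m + 3 * j + 2)"
    and 2: "real (block_start \<kappa> m + 3 * j) < real (block_start \<kappa> n + 3 * i + 2)"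
    using assms(3,4) by (auto simp: cell_def)
  have nat1: "block_start \<kappa> n + 3 * i < block_start \<kappa> m + 3 * j + 2"
    and nat2: "block_start \<kappa> m + 3 * j < block_start \<kappa> n + 3 * i + 2"
    using 1 2 by (simp_all only: of_nat_less_iff)
  have b: "1 \<le> n" "1 \<le> m" "i \<le> label_count \<kappa> n" "j \<le> label_count \<kappa> m"
    using assms(1,2) by (auto simp: labels_def)
  have "n = m"
  proof (rule ccontr)
    assume "n \<noteq> m"
    then consider "n < m" | "m < n" by linarith
    then show False
    proof cases
      case 1
      then show False using block_start_step[of n m \<kappa>] b nat1 nat2 by simp
    next
      case 2
      then show False using block_start_step[of m n \<kappa>] b nat1 nat2 by simp
    qed
  qed
  with nat1 nat2 show ?thesis by auto
qed

lemma label_eq: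
  assumes "(n, i) \<in> labels \<kappa>" "x \<in> cell \<kappa> n i"
  shows "label \<kappa> x = (n, i)"
  unfolding label_def
proof (rule the_equality)
  show "(n, i) \<in> labels \<kappa> \<and> x \<in> cell \<kappa> (fst (n, i)) (snd (n, i))"
    using assms by simp
next
  fix p assume p: "p \<in> labels \<kappa> \<and> x \<in> cell \<kappa> (fst p) (snd p)"
  have "fst p = n \<and> snd p = i"
    by (rule cell_unique[of _ _ \<kappa> _ _ x]) (use p assms in simp_all)
  then show "p = (n, i)" by (simp add: prod_eq_iff)
qed

lemma cell_space_eq: "cell_space \<kappa> = (\<Union>(n, i)\<in>labels \<kappa>. cell \<kappa> n i)"
  by (auto simp: cell_space_def labels_def)

lemma sets_cell_space [measurable]: "cell_space \<kappa> \<in> sets borel"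
  unfolding cell_space_def cell_def by measurable

lemma sets_cell_measure: "sets (cell_measure \<kappa>) = sets (restrict_space borel (cell_space \<kappa>))"
  unfolding cell_measure_def
  by (metis sets.sigma_sets_eq sets.space_closed sets_measure_of space_restrict_space space_borel
      Int_UNIV_right)

lemma space_cell_measure: "space (cell_measure \<kappa>) = cell_space \<kappa>"
  using sets_eq_imp_space_eq[OF sets_cell_measure, of \<kappa>] by (simp add: space_restrict_space)

lemma emeasure_cell_measure:
  assumes "A \<in> sets (cell_measure \<kappa>)"
  shows "emeasure (cell_measure \<kappa>) A = cell_measure_fun \<kappa> A"
proof (rule emeasure_measure_of[OF cell_measure_def])
  let ?S = "sets (restrict_space borel (cell_space \<kappa>))"
  show "?S \<subseteq> Pow (cell_space \<kappa>)"
    using sets.space_closed[of "restrict_space borel (cell_space \<kappa>)"]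
    by (simp add: space_restrict_space)
  show "A \<in> sets (cell_measure \<kappa>)" by fact
  show "positive (sets (cell_measure \<kappa>)) (cell_measure_fun \<kappa>)"
    by (simp add: positive_def cell_measure_fun_def)
  show "countably_additive (sets (cell_measure \<kappa>)) (cell_measure_fun \<kappa>)"
  proof (rule countably_additiveI)
    fix F :: "nat \<Rightarrow> real set"
    assume F: "range F \<subseteq> sets (cell_measure \<kappa>)" and disj: "disjoint_family F"
    have Fb: "F k \<in> sets borel" for k
    proof -
      have "F k \<in> sets (restrict_space borel (cell_space \<kappa>))"
        using F by (auto simp only: sets_cell_measure)
      then show ?thesis
        using sets_cell_space[of \<kappa>] by (auto simp: sets_restrict_space)
    qed
    have cb: "cell \<kappa> n i \<in> sets borel" for n i
      by (simp add: cell_def)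
    have add: "(\<Sum>k. emeasure lborel (F k \<inter> cell \<kappa> n i)) = emeasure lborel (\<Union> (range F) \<inter> cell \<kappa> n i)"
      for n i
    proof -
      have "(\<Sum>k. emeasure lborel (F k \<inter> cell \<kappa> n i)) = emeasure lborel (\<Union>k. F k \<inter> cell \<kappa> n i)"
      proof (rule suminf_emeasure)
        show "range (\<lambda>k. F k \<inter> cell \<kappa> n i) \<subseteq> sets lborel"
          using Fb cb by auto
        show "disjoint_family (\<lambda>k. F k \<inter> cell \<kappa> n i)"
          using disj by (rule disjoint_family_on_bisimulation) auto
      qed
      then show ?thesis by simp
    qed
    have "(\<Sum>k. cell_measure_fun \<kappa> (F k)) =
      (\<Sum>n k. \<Sum>i\<le>label_count \<kappa> (Suc n).
        ennreal (weight (Suc n) / (real (label_count \<kappa> (Suc n)) + 1))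
          * emeasure lborel (F k \<inter> cell \<kappa> (Suc n) i))"
      unfolding cell_measure_fun_def
      by (simp only: nn_integral_count_space_nat[symmetric])
        (rule nn_integral_suminf[symmetric, unfolded nn_integral_count_space_nat[symmetric]], simp)
    also have "\<dots> = cell_measure_fun \<kappa> (\<Union> (range F))"
      unfolding cell_measure_fun_def add[symmetric]
      by (simp add: suminf_sum)
    finally show "(\<Sum>k. cell_measure_fun \<kappa> (F k)) = cell_measure_fun \<kappa> (\<Union> (range F))" .
  qed
qed

lemma zeta3: "summable (\<lambda>k. 1 / real (Suc k) ^ 3)" "zeta3 > 0"
proof -
  show s: "summable (\<lambda>k. 1 / real (Suc k) ^ 3)"
    using inverse_power_summable[of 3, where 'a=real]
      summable_Suc_iff[of "\<lambda>n. inverse (real n ^ 3)"]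
    by (simp add: inverse_eq_divide)
  show "zeta3 > 0"
    unfolding zeta3_def by (rule suminf_pos[OF s]) simp
qed

lemma prob_space_cell_measure: "prob_space (cell_measure \<kappa>)"
proof (rule prob_spaceI)
  have cell: "emeasure lborel (cell_space \<kappa> \<inter> cell \<kappa> (Suc n) i) = 1"
    if "i \<le> label_count \<kappa> (Suc n)" for n i
  proof -
    have "cell_space \<kappa> \<inter> cell \<kappa> (Suc n) i = cell \<kappa> (Suc n) i"
      using that by (fastforce simp: cell_space_def)
    then show ?thesis by (simp add: cell_def)
  qed
  have inner: "(\<Sum>i\<le>label_count \<kappa> (Suc n).
      ennreal (weight (Suc n) / (real (label_count \<kappa> (Suc n)) + 1))
        * emeasure lborel (cell_space \<kappa> \<inter> cell \<kappa> (Suc n) i)) = ennreal (weight (Suc n))" for n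
  proof -
    have "0 \<le> weight (Suc n)" using zeta3(2) by (simp add: weight_def)
    then show ?thesis
      by (simp add: cell ennreal_of_nat_eq_real_of_nat ennreal_mult[symmetric]
          del: of_nat_Suc) (simp add: field_simps)
  qed
  have "(\<lambda>n. weight (Suc n)) sums ((1 / zeta3) * zeta3)"
    unfolding weight_def zeta3_def by (intro sums_mult summable_sums zeta3(1))
  then have "(\<lambda>n. weight (Suc n)) sums 1" using zeta3(2) by simp
  then have "(\<Sum>n. ennreal (weight (Suc n))) = ennreal 1"
    by (intro suminf_ennreal_eq) (use zeta3(2) in \<open>auto simp: weight_def\<close>)
  then show "emeasure (cell_measure \<kappa>) (space (cell_measure \<kappa>)) = 1"
    by (simp only: emeasure_cell_measure[OF sets.top])
      (simp add: cell_measure_fun_def space_cell_measure inner)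
qed

end

theory Submission
  imports Defs "HOL-Real_Asymp.Real_Asymp"
begin

text \<open>The cost depends only on labels. Averaging a coupling over pairs of cells and symmetrising it
  keeps the marginals and the cost, and by Gibbs' inequality it strictly lowers the entropy unless
  nothing changes; so the minimiser has a density that is a symmetric function of the labels, with
  cell masses \<open>\<pi> i j\<close>. Shifting mass between the four cells spanned by two labels \<open>i \<noteq> j\<close> shows
  \<open>(\<pi> i j)\<^sup>2 exp (2 c i j / \<epsilon>) = \<pi> i i * \<pi> j j\<close>.

  Hence every cell that pairs two distinct nonzero indices of one block has mass at most
  \<open>exp (- b / \<epsilon>)\<close>, and any rate function is at least \<open>b\<close> on the clopen union \<open>C\<close> of these cells.
  But there are about \<open>exp (\<kappa> n)\<close> indices in block \<open>n\<close>, so for \<open>n\<close> about \<open>b / (\<kappa> \<epsilon>)\<close> the number of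
  cells compensates the factor \<open>exp (- b / \<epsilon>)\<close>, and the four-point identity forces \<open>C\<close> to carry
  a fixed fraction of the mass of that block, which is of order \<open>\<epsilon>\<^sup>3\<close>. Little mass leaves the
  block, because the total cost is at most \<open>\<epsilon>\<close> times the finite label entropy. So the rate of
  \<open>C\<close> is 0, against the upper bound \<open>- b\<close>.\<close>

section \<open>Measures with labelled points\<close>

text \<open>Densities and \<open>KL\<close> refer to the product of two measures, whereas
  \<open>couplings\<close> asks for the Borel sets of the subspace \<open>S \<times> S\<close>.
  Second countability identifies the two sigma-algebras.\<close>

lemma sets_pair_restrict_borel:
  fixes S :: "'a::second_countable_topology set" and T :: "'b::second_countable_topology set"
  shows "sets (restrict_space borel S \<Otimes>\<^sub>M restrict_space borel T) = sets (restrict_space borel (S \<times> T))"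
proof (rule antisym)
  let ?R = "restrict_space borel S \<Otimes>\<^sub>M restrict_space borel T"
  have space: "space ?R = S \<times> T"
    by (simp add: space_pair_measure space_restrict_space)
  show "sets ?R \<subseteq> sets (restrict_space borel (S \<times> T))"
  proof (rule sets_pair_in_sets)
    fix A B assume "A \<in> sets (restrict_space borel S)" "B \<in> sets (restrict_space borel T)"
    then obtain A' B' where "A = S \<inter> A'" "B = T \<inter> B'" "A' \<in> sets borel" "B' \<in> sets borel"
      by (auto simp: sets_restrict_space)
    then have "A \<times> B = (S \<times> T) \<inter> (A' \<times> B')" "A' \<times> B' \<in> sets borel"
      by (auto intro: borel_Times)
    then show "A \<times> B \<in> sets (restrict_space borel (S \<times> T))"
      by (auto simp: sets_restrict_space)
  qed
  have "id \<in> borel_measurable ?R"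
    unfolding borel_prod[symmetric] id_def
    by (rule measurable_pair) (auto simp: comp_def intro!: measurable_compose[OF measurable_fst]
        measurable_compose[OF measurable_snd] measurable_restrict_space1)
  then show "sets (restrict_space borel (S \<times> T)) \<subseteq> sets ?R"
    by (auto simp: sets_restrict_space space Int_commute dest!: measurable_sets)
qed

text \<open>The Radon-Nikodym derivative of a density is that density almost everywhere, so
  \<open>KL\<close> becomes a plain integral. Where \<open>f\<close> vanishes the integrand is 0,
  whatever value \<open>ln 0\<close> has.\<close>

lemma KL_density_eq:
  assumes "prob_space R" and f [measurable]: "f \<in> borel_measurable R" and nn: "\<And>x. 0 \<le> f x"
  shows "KL (density R (\<lambda>x. ennreal (f x))) R =
    (if integrable R (\<lambda>x. f x * ln (f x)) then ereal (\<integral>x. f x * ln (f x) \<partial>R) else \<infinity>)"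
proof -
  interpret prob_space R by fact
  let ?N = "density R (\<lambda>x. ennreal (f x))"
  have ln: "log (exp 1) = ln" by (simp add: fun_eq_iff log_def)
  have "AE x in R. ennreal (f x) = RN_deriv R ?N x"
    by (rule RN_deriv_unique) auto
  then have ae: "AE x in R. f x * entropy_density (exp 1) R ?N x = f x * ln (f x)"
  proof eventually_elim
    case (elim x)
    have "enn2real (RN_deriv R ?N x) = f x" by (simp add: elim[symmetric] nn)
    then show ?case by (simp add: entropy_density_def ln)
  qed
  have [measurable]: "entropy_density (exp 1) R ?N \<in> borel_measurable R"
    unfolding entropy_density_def comp_def ln by measurable
  have "integrable ?N (entropy_density (exp 1) R ?N) \<longleftrightarrow>
      integrable R (\<lambda>x. f x * entropy_density (exp 1) R ?N x)"
    by (rule integrable_real_density) (auto simp: nn)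
  also have "\<dots> \<longleftrightarrow> integrable R (\<lambda>x. f x * ln (f x))"
    by (rule integrable_cong_AE[OF _ _ ae]) auto
  finally have 1: "integrable ?N (entropy_density (exp 1) R ?N) \<longleftrightarrow> integrable R (\<lambda>x. f x * ln (f x))" .
  have 2: "KL_divergence (exp 1) R ?N = (\<integral>x. f x * ln (f x) \<partial>R)"
    using KL_density[of "exp 1" f] nn by (simp add: ln)
  have 3: "absolutely_continuous R ?N" by (rule absolutely_continuousI_density) measurable
  show ?thesis unfolding KL_def using 1 2 3 by simp
qed

text \<open>Finite divergence includes absolute continuity, and for finite measures the derivative
  can be chosen real and nonnegative everywhere, which makes \<open>KL_density_eq\<close>
  applicable.\<close>

lemma KL_finite_density:
  assumes "prob_space R" "prob_space P" "sets P = sets R" "KL P R \<noteq> \<infinity>"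
  obtains f where "f \<in> borel_measurable R" "\<And>x. 0 \<le> f x" "P = density R (\<lambda>x. ennreal (f x))"
    "integrable R (\<lambda>x. f x * ln (f x))" "KL P R = ereal (\<integral>x. f x * ln (f x) \<partial>R)"
proof -
  interpret R: prob_space R by fact
  interpret P: prob_space P by fact
  have ac: "absolutely_continuous R P"
    using assms(4) by (auto simp: KL_def split: if_splits)
  obtain D where D [measurable]: "D \<in> borel_measurable R" and ae: "AE x in R. RN_deriv R P x = ennreal (D x)"
    and nn: "\<And>x. 0 \<le> D x"
    using R.real_RN_deriv[OF P.finite_measure_axioms ac assms(3)] by blast
  have "P = density R (RN_deriv R P)"
    using R.density_RN_deriv[OF ac assms(3)] by simp
  also have "\<dots> = density R (\<lambda>x. ennreal (D x))"
    by (rule density_cong) (auto intro: ae)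
  finally have P: "P = density R (\<lambda>x. ennreal (D x))" .
  show ?thesis
    by (rule that[OF D nn P])
      (use KL_density_eq[OF assms(1) D nn] assms(4) in \<open>auto simp: P[symmetric] split: if_splits\<close>)
qed

section \<open>Convexity inequalities for x ln x, and integrals over countable types\<close>

text \<open>For positive \<open>f\<close> and \<open>g\<close> the expression is
  \<open>f * (u - 1 - ln u)\<close> with \<open>u = g / f\<close>, and
  \<open>ln u \<le> u - 1\<close> is strict unless \<open>u = 1\<close>. Integrated over densities
  this is Gibbs' inequality with its equality case.\<close>

lemma gibbs_pointwise:
  fixes f g :: real
  assumes "0 \<le> f" "0 \<le> g" "g = 0 \<Longrightarrow> f = 0"
  shows "0 \<le> g - f + f * ln f - f * ln g"
    and "g - f + f * ln f - f * ln g = 0 \<Longrightarrow> f = g"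
proof -
  have *: "0 \<le> g - f + f * ln f - f * ln g \<and> (g - f + f * ln f - f * ln g = 0 \<longrightarrow> f = g)"
  proof (cases "f = 0")
    case False
    with assms have p: "0 < f" "0 < g" by force+
    have eq: "g - f + f * ln f - f * ln g = f * ((g / f - 1) - ln (g / f))"
      using p by (simp add: ln_div field_simps)
    have le: "ln (g / f) \<le> g / f - 1" using p by (intro ln_le_minus_one) simp
    moreover have "g / f = 1" if "ln (g / f) = g / f - 1"
      using p ln_eq_minus_one[of "g / f"] that by simp
    ultimately show ?thesis unfolding eq using p by (auto simp: mult_nonneg_nonneg)
  qed (use assms in auto)
  then show "0 \<le> g - f + f * ln f - f * ln g"
    and "g - f + f * ln f - f * ln g = 0 \<Longrightarrow> f = g" by auto
qed

lemma xlnx_ge: "x - 1 \<le> x * ln x" if "0 \<le> x" for x :: real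
  using gibbs_pointwise(1)[of x 1] that by simp

text \<open>By convexity the increment is bounded by the slope at the end point \<open>y\<close>.
  Using the slope there, and not at \<open>x\<close>, allows the starting density to vanish.\<close>

lemma xlnx_diff_le:
  fixes x y :: real
  assumes "0 \<le> x" "0 < y"
  shows "y * ln y - x * ln x \<le> (y - x) * (ln y + 1)"
  using gibbs_pointwise(1)[of x y] assms by (simp add: algebra_simps)

lemma ennreal_double_cancel: "2 * x = y + y \<Longrightarrow> x = y" for x y :: ennreal
  by (simp add: mult_2[symmetric] ennreal_mult_cancel_left)

lemma nn_integral_countable_type:
  fixes N :: "'k::countable measure"
  assumes "sets N = UNIV"
  shows "(\<integral>\<^sup>+k. h k \<partial>N) = (\<integral>\<^sup>+k. emeasure N {k} * h k \<partial>count_space UNIV)"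
proof -
  have "N = density (count_space UNIV) (\<lambda>k. emeasure N {k})"
  proof (rule measure_eqI_countable[of _ UNIV])
    show "emeasure N {a} = emeasure (density (count_space UNIV) (\<lambda>k. emeasure N {k})) {a}" for a
      by (simp add: emeasure_density nn_integral_count_space_indicator[symmetric]
          nn_integral_count_space_finite)
  qed (use assms in auto)
  then have "(\<integral>\<^sup>+k. h k \<partial>N) = (\<integral>\<^sup>+k. h k \<partial>density (count_space UNIV) (\<lambda>k. emeasure N {k}))"
    by simp
  then show ?thesis by (simp add: nn_integral_density)
qed

section \<open>Label masses and integrals of functions of the labels\<close>

text \<open>This abstracts from the geometry of the cells. Positivity of mass is required only for
  labels that occur at some point. Finiteness of the label entropy makes staying inside one's own
  cell an admissible competitor and bounds the entropy of every density that depends on labels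
  only.\<close>

locale labelled_space = prob_space M
  for M :: "'a::second_countable_topology measure" +
  fixes S :: "'a set" and l :: "'a \<Rightarrow> 'l::countable" and c :: "'l \<Rightarrow> 'l \<Rightarrow> real"
  assumes sets_M: "sets M = sets (restrict_space borel S)"
    and label_measurable [measurable]: "l \<in> M \<rightarrow>\<^sub>M count_space UNIV"
    and label_mass_pos: "x \<in> space M \<Longrightarrow> 0 < prob {y \<in> space M. l y = l x}"
    and label_entropy_finite: "integrable M (\<lambda>x. ln (prob {y \<in> space M. l y = l x}))"
    and c_nonneg: "0 \<le> c i j" and c_sym: "c i j = c j i" and c_diag: "c i i = 0"
begin

sublocale pair: pair_prob_space M M ..

definition mass :: "'l \<Rightarrow> real" where
  "mass i = prob {x \<in> space M. l x = i}"

abbreviation lift :: "('l \<Rightarrow> 'l \<Rightarrow> 'b) \<Rightarrow> 'a \<times> 'a \<Rightarrow> 'b" where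
  "lift h z \<equiv> h (l (fst z)) (l (snd z))"

abbreviation product :: "('a \<times> 'a) measure" where
  "product \<equiv> M \<Otimes>\<^sub>M M"

definition label_entropy :: real where
  "label_entropy = (\<integral>x. - ln (mass (l x)) \<partial>M)"

lemma sets_product: "sets product = sets (restrict_space borel (S \<times> S))"
  by (simp add: sets_pair_restrict_borel[symmetric] sets_pair_measure_cong[OF sets_M sets_M])

lemma mass_nonneg [simp]: "0 \<le> mass i" and mass_le_1: "mass i \<le> 1"
  by (simp_all add: mass_def)

lemma mass_label_pos: "x \<in> space M \<Longrightarrow> 0 < mass (l x)"
  unfolding mass_def by (rule label_mass_pos)

lemma integrable_ln_mass: "integrable M (\<lambda>x. ln (mass (l x)))"
  unfolding mass_def by (rule label_entropy_finite)

lemma label_pair_measurable: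
  "(\<lambda>z. (l (fst z), l (snd z))) \<in> product \<rightarrow>\<^sub>M count_space UNIV"
  unfolding measurable_count_space_eq2_countable
proof (intro conjI ballI)
  fix a :: "'l \<times> 'l"
  have "(\<lambda>z. (l (fst z), l (snd z))) -` {a} \<inter> space product =
    {z \<in> space product. l (fst z) = fst a \<and> l (snd z) = snd a}"
    by (auto simp: prod_eq_iff)
  also have "\<dots> \<in> sets product" by measurable
  finally show "(\<lambda>z. (l (fst z), l (snd z))) -` {a} \<inter> space product \<in> sets product" .
qed auto

lemma lift_measurable: "(\<lambda>z. lift h z) \<in> product \<rightarrow>\<^sub>M N" if "\<And>i j. h i j \<in> space N"
proof -
  have "(\<lambda>p. h (fst p) (snd p)) \<in> count_space UNIV \<rightarrow>\<^sub>M N" using that by auto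
  from measurable_compose[OF label_pair_measurable this] show ?thesis by simp
qed

lemma lift_borel [simp]: "(\<lambda>z. lift h z) \<in> borel_measurable product"
  by (rule lift_measurable) simp

lemma emeasure_label: "emeasure M {x \<in> space M. l x = i} = ennreal (mass i)"
  by (simp add: mass_def emeasure_eq_measure)

lemma emeasure_product_label:
  "emeasure product {z \<in> space product. l (fst z) = i \<and> l (snd z) = j} = ennreal (mass i * mass j)"
proof -
  have eq: "{z \<in> space product. l (fst z) = i \<and> l (snd z) = j} =
      {x \<in> space M. l x = i} \<times> {x \<in> space M. l x = j}"
    by (auto simp: space_pair_measure)
  have "emeasure product ({x \<in> space M. l x = i} \<times> {x \<in> space M. l x = j}) = emeasure M {x \<in> space M. l x = i} * emeasure M {x \<in> space M. l x = j}"
    by (rule emeasure_pair_measure_Times) measurable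
  also have "\<dots> = ennreal (mass i * mass j)"
    unfolding emeasure_label by (rule ennreal_mult[symmetric]) simp_all
  finally show ?thesis unfolding eq .
qed

text \<open>Pushing \<open>P\<close> forward to the countable set of label pairs turns the integral
  into a sum over cells. Hence \<open>P\<close> enters only through its cell masses, and replacing
  \<open>P\<close> by a cell average can be checked cell by cell.\<close>

lemma nn_integral_lift:
  assumes "sets P = sets product"
  shows "(\<integral>\<^sup>+z. lift h z \<partial>P) = (\<integral>\<^sup>+p. emeasure P {z \<in> space product. l (fst z) = fst p \<and> l (snd z) = snd p} *
    h (fst p) (snd p) \<partial>count_space UNIV)"
proof -
  let ?L = "\<lambda>z. (l (fst z), l (snd z))"
  have L: "?L \<in> P \<rightarrow>\<^sub>M count_space UNIV"
    using label_pair_measurable by (simp add: measurable_cong_sets[OF assms refl])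
  have "(\<integral>\<^sup>+z. lift h z \<partial>P) = (\<integral>\<^sup>+p. h (fst p) (snd p) \<partial>distr P (count_space UNIV) ?L)"
    using L by (subst nn_integral_distr) auto
  also have "\<dots> = (\<integral>\<^sup>+p. emeasure (distr P (count_space UNIV) ?L) {p} * h (fst p) (snd p) \<partial>count_space UNIV)"
    by (rule nn_integral_countable_type) simp
  also have "(\<lambda>p. emeasure (distr P (count_space UNIV) ?L) {p}) = (\<lambda>p.
      emeasure P {z \<in> space product. l (fst z) = fst p \<and> l (snd z) = snd p})"
    by (subst emeasure_distr[OF L])
      (auto intro!: ext arg_cong[where f = "emeasure P"] simp: sets_eq_imp_space_eq[OF assms])
  finally show ?thesis .
qed

section \<open>Symmetric label densities that are couplings\<close>

text \<open>Only the integral over the second variable is prescribed; symmetry turns it into the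
  condition for the other marginal. Labels of mass 0 carry no marginal condition.\<close>

definition plan :: "('l \<Rightarrow> 'l \<Rightarrow> real) \<Rightarrow> bool" where
  "plan g \<longleftrightarrow> (\<forall>i j. 0 \<le> g i j) \<and> (\<forall>i j. g i j = g j i) \<and>
     (\<forall>i. 0 < mass i \<longrightarrow> (\<integral>\<^sup>+y. g i (l y) \<partial>M) = 1)"

abbreviation plan_measure :: "('l \<Rightarrow> 'l \<Rightarrow> real) \<Rightarrow> ('a \<times> 'a) measure" where
  "plan_measure g \<equiv> density product (\<lambda>z. ennreal (lift g z))"

lemma planD:
  assumes "plan g"
  shows "0 \<le> g i j" "g i j = g j i" "0 < mass i \<Longrightarrow> (\<integral>\<^sup>+y. g i (l y) \<partial>M) = 1"
  using assms unfolding plan_def by blast+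

lemma label_comp_borel [simp]: "(\<lambda>y. f (l y)) \<in> borel_measurable M"
  by (rule measurable_compose[OF label_measurable]) simp

lemma nn_integral_plan_fst:
  assumes "plan g" and [measurable]: "h \<in> borel_measurable M"
  shows "(\<integral>\<^sup>+z. ennreal (lift g z) * h (fst z) \<partial>product) = (\<integral>\<^sup>+x. h x \<partial>M)"
proof -
  have [measurable]: "(\<lambda>z. lift g z) \<in> borel_measurable product" by (rule lift_borel)
  have "(\<integral>\<^sup>+z. ennreal (lift g z) * h (fst z) \<partial>product) =
      (\<integral>\<^sup>+x. \<integral>\<^sup>+y. ennreal (g (l x) (l y)) * h x \<partial>M \<partial>M)"
    by (subst nn_integral_fst[symmetric]) auto
  also have "\<dots> = (\<integral>\<^sup>+x. h x \<partial>M)"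
  proof (rule nn_integral_cong)
    fix x assume "x \<in> space M"
    then show "(\<integral>\<^sup>+y. ennreal (g (l x) (l y)) * h x \<partial>M) = h x"
      by (simp add: nn_integral_multc planD(3)[OF assms(1) mass_label_pos])
  qed
  finally show ?thesis .
qed

lemma product_swap: "distr product product (\<lambda>(x, y). (y, x)) = product"
  by (rule pair.distr_pair_swap[symmetric])

text \<open>Exchanging the coordinates preserves the product measure and the symmetric density,
  which reduces this to the first marginal.\<close>

lemma nn_integral_plan_snd:
  assumes "plan g" and [measurable]: "h \<in> borel_measurable M"
  shows "(\<integral>\<^sup>+z. ennreal (lift g z) * h (snd z) \<partial>product) = (\<integral>\<^sup>+x. h x \<partial>M)"
proof -
  have [measurable]: "(\<lambda>z. lift g z) \<in> borel_measurable product" by (rule lift_borel)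
  have "(\<integral>\<^sup>+z. ennreal (lift g z) * h (snd z) \<partial>product) =
      (\<integral>\<^sup>+z. ennreal (lift g z) * h (snd z) \<partial>distr product product (\<lambda>(x, y). (y, x)))"
    by (simp add: product_swap)
  also have "\<dots> = (\<integral>\<^sup>+z. ennreal (lift g z) * h (fst z) \<partial>product)"
    by (subst nn_integral_distr)
      (auto simp: case_prod_beta intro!: nn_integral_cong planD(2)[OF assms(1)] arg_cong2[where f="(*)"] arg_cong[where f=ennreal])
  finally show ?thesis by (simp add: nn_integral_plan_fst[OF assms])
qed

lemma plan_distr:
  assumes "plan g"
  shows "distr (plan_measure g) M fst = M" "distr (plan_measure g) M snd = M"
proof -
  have [measurable]: "(\<lambda>z. lift g z) \<in> borel_measurable product" by (rule lift_borel)
  show "distr (plan_measure g) M fst = M"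
  proof (rule measure_eqI)
    fix A assume A: "A \<in> sets (distr (plan_measure g) M fst)"
    then have [measurable]: "A \<in> sets M" by simp
    have "emeasure (distr (plan_measure g) M fst) A =
        (\<integral>\<^sup>+z. ennreal (lift g z) * indicator A (fst z) \<partial>product)"
      by (subst emeasure_distr) (auto simp: emeasure_density indicator_def intro!: nn_integral_cong)
    then show "emeasure (distr (plan_measure g) M fst) A = emeasure M A"
      by (simp add: nn_integral_plan_fst[OF assms])
  qed simp
  show "distr (plan_measure g) M snd = M"
  proof (rule measure_eqI)
    fix A assume A: "A \<in> sets (distr (plan_measure g) M snd)"
    then have [measurable]: "A \<in> sets M" by simp
    have "emeasure (distr (plan_measure g) M snd) A =
        (\<integral>\<^sup>+z. ennreal (lift g z) * indicator A (snd z) \<partial>product)"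
      by (subst emeasure_distr) (auto simp: emeasure_density indicator_def intro!: nn_integral_cong)
    then show "emeasure (distr (plan_measure g) M snd) A = emeasure M A"
      by (simp add: nn_integral_plan_snd[OF assms])
  qed simp
qed

lemma plan_prob_space:
  assumes "plan g"
  shows "prob_space (plan_measure g)"
  using nn_integral_plan_fst[OF assms, of "\<lambda>_. 1"]
  by (intro prob_spaceI) (simp add: emeasure_density emeasure_space_1 cong: nn_integral_cong)

lemma plan_coupling:
  assumes "plan g"
  shows "plan_measure g \<in> couplings S M M"
  unfolding couplings_def
  using plan_prob_space[OF assms] plan_distr[OF assms] sets_product by simp

lemma integrable_plan_fst:
  fixes h :: "'a \<Rightarrow> real"
  assumes "plan g" "integrable M h"
  shows "integrable product (\<lambda>z. lift g z * h (fst z))"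
    "(\<integral>z. lift g z * h (fst z) \<partial>product) = (\<integral>x. h x \<partial>M)"
proof -
  have [measurable]: "(\<lambda>z. lift g z) \<in> borel_measurable product" by (rule lift_borel)
  have [measurable]: "h \<in> borel_measurable M" using assms(2) by simp
  have "integrable (distr (plan_measure g) M fst) h"
    using assms(2) by (simp add: plan_distr[OF assms(1)])
  then have "integrable (plan_measure g) (\<lambda>z. h (fst z))"
    by (subst (asm) integrable_distr_eq) auto
  then show "integrable product (\<lambda>z. lift g z * h (fst z))"
    by (subst (asm) integrable_real_density) (auto simp: planD(1)[OF assms(1)])
  have "(\<integral>x. h x \<partial>M) = (\<integral>x. h x \<partial>distr (plan_measure g) M fst)"
    by (simp add: plan_distr[OF assms(1)])
  also have "\<dots> = (\<integral>z. h (fst z) \<partial>plan_measure g)"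
    by (rule integral_distr) auto
  also have "\<dots> = (\<integral>z. lift g z * h (fst z) \<partial>product)"
    by (rule integral_real_density) (auto simp: planD(1)[OF assms(1)])
  finally show "(\<integral>z. lift g z * h (fst z) \<partial>product) = (\<integral>x. h x \<partial>M)" ..
qed

text \<open>The function \<open>g j\<close> integrates to 1 over the space, and the points with
  label \<open>i\<close> alone contribute \<open>g j i * mass i\<close>.\<close>

lemma plan_le_inverse_mass:
  assumes "plan g" "0 < mass i" "0 < mass j"
  shows "g i j \<le> 1 / mass i"
proof -
  have "ennreal (g j i * mass i) = (\<integral>\<^sup>+y. ennreal (g j i) * indicator {x \<in> space M. l x = i} y \<partial>M)"
    by (simp add: nn_integral_cmult emeasure_label ennreal_mult planD(1)[OF assms(1)])
  also have "\<dots> \<le> (\<integral>\<^sup>+y. ennreal (g j (l y)) \<partial>M)"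
    by (rule nn_integral_mono) (auto simp: indicator_def)
  also have "\<dots> = 1" by (rule planD(3)[OF assms(1,3)])
  finally have "g j i * mass i \<le> 1" by simp
  then show ?thesis using assms(2) planD(2)[OF assms(1), of i j] by (simp add: field_simps)
qed

text \<open>The integrand lies between \<open>- 1\<close> and \<open>g\<close> times
  \<open>- ln\<close> of the mass of the first label. The marginal condition turns the integral of
  the upper bound into the finite label entropy.\<close>

lemma plan_entropy:
  assumes "plan g"
  shows "integrable product (\<lambda>z. lift g z * ln (lift g z))"
proof (rule Bochner_Integration.integrable_bound)
  show "integrable product (\<lambda>z. 1 + lift g z * (- ln (mass (l (fst z)))))"
    using integrable_plan_fst(1)[OF assms, of "\<lambda>x. - ln (mass (l x))"] integrable_ln_mass by simp
  show "AE z in product. norm (lift g z * ln (lift g z)) \<le> norm (1 + lift g z * (- ln (mass (l (fst z)))))"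
  proof (rule AE_I2)
    fix z assume "z \<in> space product"
    then have pos: "0 < mass (l (fst z))" "0 < mass (l (snd z))"
      by (auto simp: space_pair_measure mass_label_pos)
    have nn: "0 \<le> lift g z" by (rule planD(1)[OF assms])
    have lower: "- 1 \<le> lift g z * ln (lift g z)" using xlnx_ge[OF nn] nn by linarith
    have m: "0 \<le> - ln (mass (l (fst z)))" using pos(1) mass_le_1 by simp
    have upper: "lift g z * ln (lift g z) \<le> lift g z * (- ln (mass (l (fst z))))"
    proof (cases "lift g z = 0")
      case False
      then have "ln (lift g z) \<le> ln (1 / mass (l (fst z)))"
        using nn plan_le_inverse_mass[OF assms pos] pos by (subst ln_le_cancel_iff) auto
      then show ?thesis using nn pos by (intro mult_left_mono) (simp_all add: ln_div)
    qed simp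
    have "0 \<le> lift g z * (- ln (mass (l (fst z))))" using nn m by (rule mult_nonneg_nonneg)
    with lower upper show "norm (lift g z * ln (lift g z)) \<le> norm (1 + lift g z * (- ln (mass (l (fst z)))))"
      by simp
  qed
qed simp

text \<open>A Bochner integral is 0 for a non-integrable cost, so every comparison of plan values
  carries integrability of the cost as a hypothesis.\<close>

definition plan_value :: "real \<Rightarrow> ('l \<Rightarrow> 'l \<Rightarrow> real) \<Rightarrow> real" where
  "plan_value \<epsilon> g = (\<integral>z. lift c z * lift g z \<partial>product) + \<epsilon> * (\<integral>z. lift g z * ln (lift g z) \<partial>product)"

lemma KL_plan:
  assumes "plan g"
  shows "KL (plan_measure g) product = ereal (\<integral>z. lift g z * ln (lift g z) \<partial>product)"
  by (subst KL_density_eq)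
    (auto simp: pair.prob_space_axioms planD(1)[OF assms] plan_entropy[OF assms])

lemma nn_cost_plan:
  assumes "plan g"
  shows "(\<integral>\<^sup>+(x, y). ennreal (c (l x) (l y)) \<partial>plan_measure g) = (\<integral>\<^sup>+z. ennreal (lift c z * lift g z) \<partial>product)"
  by (simp add: case_prod_beta nn_integral_density ennreal_mult planD(1)[OF assms] c_nonneg mult.commute)

lemma entropic_cost_plan:
  assumes "plan g" "integrable product (\<lambda>z. lift c z * lift g z)"
  shows "entropic_cost (\<lambda>x y. c (l x) (l y)) M \<epsilon> (plan_measure g) = ereal (plan_value \<epsilon> g)"
proof -
  have "(\<integral>\<^sup>+z. ennreal (lift c z * lift g z) \<partial>product) = ennreal (\<integral>z. lift c z * lift g z \<partial>product)"
    by (rule nn_integral_eq_integral[OF assms(2)]) (simp add: c_nonneg planD(1)[OF assms(1)])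
  moreover have "0 \<le> (\<integral>z. lift c z * lift g z \<partial>product)"
    by (simp add: c_nonneg planD(1)[OF assms(1)])
  ultimately show ?thesis
    by (simp add: entropic_cost_def nn_cost_plan[OF assms(1)] KL_plan[OF assms(1)] plan_value_def)
qed

text \<open>The coupling that keeps the label and chooses the second point independently within the
  same cell.\<close>

definition diagonal_plan :: "'l \<Rightarrow> 'l \<Rightarrow> real" where
  "diagonal_plan i j = (if i = j then 1 / mass i else 0)"

lemma plan_diagonal: "plan diagonal_plan"
  unfolding plan_def
proof (intro conjI allI impI)
  fix i assume i: "0 < mass i"
  have "(\<integral>\<^sup>+y. ennreal (diagonal_plan i (l y)) \<partial>M) =
      (\<integral>\<^sup>+y. ennreal (1 / mass i) * indicator {x \<in> space M. l x = i} y \<partial>M)"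
    by (intro nn_integral_cong) (auto simp: diagonal_plan_def indicator_def)
  also have "\<dots> = 1"
    using i by (simp add: nn_integral_cmult emeasure_label ennreal_mult[symmetric])
  finally show "(\<integral>\<^sup>+y. ennreal (diagonal_plan i (l y)) \<partial>M) = 1" .
qed (auto simp: diagonal_plan_def)

text \<open>Equal labels cost nothing, and on the diagonal cells the logarithm of the density is
  \<open>- ln\<close> of the label mass. As a competitor this bounds the optimal value by \<epsilon>
  times the label entropy.\<close>

lemma plan_value_diagonal:
  "integrable product (\<lambda>z. lift c z * lift diagonal_plan z)"
  "plan_value \<epsilon> diagonal_plan = \<epsilon> * label_entropy"
proof -
  have z: "lift c z * lift diagonal_plan z = 0" for z
    by (simp add: diagonal_plan_def c_diag)
  show "integrable product (\<lambda>z. lift c z * lift diagonal_plan z)"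
    by (simp add: z)
  have "(\<integral>z. lift diagonal_plan z * ln (lift diagonal_plan z) \<partial>product) =
      (\<integral>z. lift diagonal_plan z * (- ln (mass (l (fst z)))) \<partial>product)"
    by (intro Bochner_Integration.integral_cong)
      (auto simp: diagonal_plan_def space_pair_measure ln_div dest: mass_label_pos)
  also have "\<dots> = label_entropy"
    using integrable_plan_fst(2)[OF plan_diagonal, of "\<lambda>x. - ln (mass (l x))"] integrable_ln_mass
    by (simp add: label_entropy_def)
  finally show "plan_value \<epsilon> diagonal_plan = \<epsilon> * label_entropy"
    by (simp add: plan_value_def z)
qed

section \<open>Averaging a coupling over pairs of cells\<close>

definition cell_mass :: "('a \<times> 'a) measure \<Rightarrow> 'l \<Rightarrow> 'l \<Rightarrow> real" where
  "cell_mass P i j = measure P {z \<in> space product. l (fst z) = i \<and> l (snd z) = j}"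

text \<open>Where a mass is 0 the quotient is the junk value 0, which is harmless since cell masses vanish there.\<close>

definition averaged_density :: "('a \<times> 'a) measure \<Rightarrow> 'l \<Rightarrow> 'l \<Rightarrow> real" where
  "averaged_density P i j = (cell_mass P i j + cell_mass P j i) / 2 / (mass i * mass j)"

lemma couplingD:
  assumes "P \<in> couplings S M M"
  shows "prob_space P" "sets P = sets product" "distr P M fst = M" "distr P M snd = M"
  using assms by (auto simp: couplings_def sets_product)

lemma label_pair_set [measurable]: "{z \<in> space product. l (fst z) = i \<and> l (snd z) = j} \<in> sets product"
  by measurable

lemma coupling_label_mass:
  assumes "P \<in> couplings S M M"
  shows "emeasure P {z \<in> space product. l (fst z) = i} = mass i"
    "emeasure P {z \<in> space product. l (snd z) = i} = mass i"
proof -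
  note P = couplingD[OF assms]
  have sp: "space P = space product" by (rule sets_eq_imp_space_eq[OF P(2)])
  have [measurable]: "fst \<in> P \<rightarrow>\<^sub>M M" "snd \<in> P \<rightarrow>\<^sub>M M"
    by (simp_all add: measurable_cong_sets[OF P(2) refl])
  have "ennreal (mass i) = emeasure (distr P M fst) {x \<in> space M. l x = i}"
    by (simp add: P(3) emeasure_label)
  also have "\<dots> = emeasure P {z \<in> space product. l (fst z) = i}"
    by (subst emeasure_distr) (auto simp: sp space_pair_measure intro!: arg_cong[where f = "emeasure P"])
  finally show "emeasure P {z \<in> space product. l (fst z) = i} = mass i" ..
  have "ennreal (mass i) = emeasure (distr P M snd) {x \<in> space M. l x = i}"
    by (simp add: P(4) emeasure_label)
  also have "\<dots> = emeasure P {z \<in> space product. l (snd z) = i}"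
    by (subst emeasure_distr) (auto simp: sp space_pair_measure intro!: arg_cong[where f = "emeasure P"])
  finally show "emeasure P {z \<in> space product. l (snd z) = i} = mass i" ..
qed

lemma cell_mass_bounds:
  assumes "P \<in> couplings S M M"
  shows "0 \<le> cell_mass P i j" "cell_mass P i j \<le> mass i" "cell_mass P i j \<le> mass j"
    "emeasure P {z \<in> space product. l (fst z) = i \<and> l (snd z) = j} = ennreal (cell_mass P i j)"
proof -
  note P = couplingD[OF assms]
  interpret P: prob_space P by fact
  have [measurable_cong]: "sets P = sets product" by fact
  show e: "emeasure P {z \<in> space product. l (fst z) = i \<and> l (snd z) = j} = ennreal (cell_mass P i j)"
    by (simp add: cell_mass_def P.emeasure_eq_measure)
  show "0 \<le> cell_mass P i j" by (simp add: cell_mass_def)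
  have s: "{z \<in> space product. l (fst z) = i} \<in> sets P" "{z \<in> space product. l (snd z) = j} \<in> sets P"
    unfolding P(2) by measurable
  have "ennreal (cell_mass P i j) \<le> ennreal (mass i)"
    unfolding e[symmetric] coupling_label_mass(1)[OF assms, symmetric]
    by (rule emeasure_mono[OF _ s(1)]) auto
  then show "cell_mass P i j \<le> mass i" by simp
  have "ennreal (cell_mass P i j) \<le> ennreal (mass j)"
    unfolding e[symmetric] coupling_label_mass(2)[OF assms, symmetric]
    by (rule emeasure_mono[OF _ s(2)]) auto
  then show "cell_mass P i j \<le> mass j" by simp
qed

lemma emeasure_plan_cell:
  assumes nn: "\<And>i j. 0 \<le> g i j"
  shows "emeasure (plan_measure g) {z \<in> space product. l (fst z) = i \<and> l (snd z) = j} =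
    ennreal (g i j * (mass i * mass j))"
proof -
  let ?C = "{z \<in> space product. l (fst z) = i \<and> l (snd z) = j}"
  have "emeasure (plan_measure g) ?C = (\<integral>\<^sup>+z. ennreal (lift g z) * indicator ?C z \<partial>product)"
    by (rule emeasure_density) auto
  also have "\<dots> = (\<integral>\<^sup>+z. ennreal (g i j) * indicator ?C z \<partial>product)"
    by (intro nn_integral_cong) (auto simp: indicator_def)
  also have "\<dots> = ennreal (g i j) * emeasure product ?C"
    by (rule nn_integral_cmult_indicator) simp
  finally show ?thesis by (simp add: emeasure_product_label ennreal_mult nn)
qed

text \<open>The averaged measure gives each cell half the sum of the masses of that cell and of its
  transpose; summation over cells does the rest. The factor 2 stands on the left to avoid halving
  extended reals.\<close>

lemma nn_integral_averaged:
  assumes "P \<in> couplings S M M"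
  shows "2 * (\<integral>\<^sup>+z. lift h z \<partial>plan_measure (averaged_density P)) =
    (\<integral>\<^sup>+z. lift h z \<partial>P) + (\<integral>\<^sup>+z. lift (\<lambda>i j. h j i) z \<partial>P)"
proof -
  let ?m = "cell_mass P"
  note m = cell_mass_bounds[OF assms]
  have a: "averaged_density P i j * (mass i * mass j) = (?m i j + ?m j i) / 2" for i j
  proof (cases "mass i = 0 \<or> mass j = 0")
    case True
    then have "?m i j = 0" "?m j i = 0"
      using m(1,2,3)[of i j] m(1,2,3)[of j i] by auto
    then show ?thesis by (simp add: averaged_density_def)
  qed (simp add: averaged_density_def)
  have nn: "0 \<le> averaged_density P i j" for i j
    by (simp add: averaged_density_def m(1))
  have e: "2 * emeasure (plan_measure (averaged_density P)) {z \<in> space product. l (fst z) = i \<and> l (snd z) = j} =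
      ennreal (?m i j) + ennreal (?m j i)" for i j
  proof -
    have "2 * ennreal ((?m i j + ?m j i) / 2) = ennreal (2 * ((?m i j + ?m j i) / 2))"
      by (subst ennreal_mult) (simp_all add: m(1))
    also have "2 * ((?m i j + ?m j i) / 2) = ?m i j + ?m j i" by simp
    also have "ennreal (?m i j + ?m j i) = ennreal (?m i j) + ennreal (?m j i)"
      by (rule ennreal_plus) (simp_all add: m(1))
    finally show ?thesis
      by (subst emeasure_plan_cell) (simp_all add: nn a)
  qed
  have "2 * (\<integral>\<^sup>+z. lift h z \<partial>plan_measure (averaged_density P)) =
      (\<integral>\<^sup>+p. 2 * (emeasure (plan_measure (averaged_density P)) {z \<in> space product. l (fst z) = fst p \<and> l (snd z) = snd p} *
        h (fst p) (snd p)) \<partial>count_space UNIV)"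
    by (subst nn_integral_lift) (simp_all add: nn_integral_cmult)
  also have "\<dots> = (\<integral>\<^sup>+p. ennreal (?m (fst p) (snd p)) * h (fst p) (snd p) +
      ennreal (?m (snd p) (fst p)) * h (fst p) (snd p) \<partial>count_space UNIV)"
    by (intro nn_integral_cong) (simp add: mult.assoc[symmetric] e distrib_right)
  also have "\<dots> = (\<integral>\<^sup>+p. ennreal (?m (fst p) (snd p)) * h (fst p) (snd p) \<partial>count_space UNIV) +
      (\<integral>\<^sup>+p. ennreal (?m (snd p) (fst p)) * h (fst p) (snd p) \<partial>count_space UNIV)"
    by (rule nn_integral_add) auto
  also have "(\<integral>\<^sup>+p. ennreal (?m (snd p) (fst p)) * h (fst p) (snd p) \<partial>count_space UNIV) =
      (\<integral>\<^sup>+p. ennreal (?m (fst p) (snd p)) * h (snd p) (fst p) \<partial>count_space UNIV)"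
  proof -
    have "bij_betw prod.swap (UNIV :: ('l \<times> 'l) set) UNIV"
      by (auto simp: bij_betw_def inj_on_def)
    from nn_integral_bij_count_space[OF this,
        of "\<lambda>p. ennreal (?m (snd p) (fst p)) * h (fst p) (snd p)"]
    show ?thesis by simp
  qed
  also have "(\<integral>\<^sup>+p. ennreal (?m (fst p) (snd p)) * h (fst p) (snd p) \<partial>count_space UNIV) = (\<integral>\<^sup>+z. lift h z \<partial>P)"
    by (subst nn_integral_lift[OF couplingD(2)[OF assms]]) (simp add: m(4))
  also have "(\<integral>\<^sup>+p. ennreal (?m (fst p) (snd p)) * h (snd p) (fst p) \<partial>count_space UNIV) =
      (\<integral>\<^sup>+z. lift (\<lambda>i j. h j i) z \<partial>P)"
    by (subst nn_integral_lift[OF couplingD(2)[OF assms], of "\<lambda>i j. h j i"]) (simp add: m(4))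
  finally show ?thesis .
qed

text \<open>Test \<open>nn_integral_averaged\<close> with the indicator \<open>h\<close> of the
  first label being \<open>i\<close>. Its transpose tests the second label, so the two marginals of
  \<open>P\<close> both give \<open>mass i\<close>; by Fubini the averaged side is the wanted
  integral times \<open>mass i\<close>, which cancels.\<close>

lemma plan_averaged:
  assumes "P \<in> couplings S M M"
  shows "plan (averaged_density P)"
  unfolding plan_def
proof (intro conjI allI impI)
  let ?g = "averaged_density P"
  note P = couplingD[OF assms]
  show nn: "0 \<le> ?g i j" for i j
    by (simp add: averaged_density_def cell_mass_bounds(1)[OF assms])
  show "?g i j = ?g j i" for i j
    by (simp add: averaged_density_def add.commute mult.commute)
  fix i assume i: "0 < mass i"
  have sp: "space P = space product" by (rule sets_eq_imp_space_eq[OF P(2)])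
  define h where "h = (\<lambda>i' (j :: 'l). indicator {i} i' :: ennreal)"
  have s: "{z \<in> space product. l (fst z) = i} \<in> sets P" "{z \<in> space product. l (snd z) = i} \<in> sets P"
    unfolding P(2) by measurable
  have "(\<integral>\<^sup>+z. lift h z \<partial>P) = (\<integral>\<^sup>+z. indicator {z \<in> space product. l (fst z) = i} z \<partial>P)"
    by (intro nn_integral_cong) (auto simp: sp h_def indicator_def)
  then have 1: "(\<integral>\<^sup>+z. lift h z \<partial>P) = mass i"
    using s by (simp add: coupling_label_mass[OF assms])
  have "(\<integral>\<^sup>+z. lift (\<lambda>i j. h j i) z \<partial>P) = (\<integral>\<^sup>+z. indicator {z \<in> space product. l (snd z) = i} z \<partial>P)"
    by (intro nn_integral_cong) (auto simp: sp h_def indicator_def)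
  then have 2: "(\<integral>\<^sup>+z. lift (\<lambda>i j. h j i) z \<partial>P) = mass i"
    using s by (simp add: coupling_label_mass[OF assms])
  let ?G = "\<integral>\<^sup>+y. ennreal (?g i (l y)) \<partial>M"
  have "ennreal (mass i) = (\<integral>\<^sup>+z. lift h z \<partial>plan_measure ?g)"
    by (rule ennreal_double_cancel[OF nn_integral_averaged[OF assms, of h, unfolded 1 2], symmetric])
  also have "\<dots> = (\<integral>\<^sup>+z. ennreal (lift ?g z) * lift h z \<partial>product)"
    by (rule nn_integral_density) auto
  also have "\<dots> = (\<integral>\<^sup>+x. \<integral>\<^sup>+y. ennreal (?g (l x) (l y)) * h (l x) (l y) \<partial>M \<partial>M)"
  proof -
    have "(\<lambda>z. ennreal (lift ?g z) * lift h z) \<in> borel_measurable product" by simp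
    from nn_integral_fst[OF this] show ?thesis by simp
  qed
  also have "\<dots> = (\<integral>\<^sup>+x. ?G * indicator {x \<in> space M. l x = i} x \<partial>M)"
    by (intro nn_integral_cong) (auto simp: h_def indicator_def)
  also have "\<dots> = ?G * mass i"
    by (subst nn_integral_cmult_indicator) (auto simp: emeasure_label)
  finally have "1 * ennreal (mass i) = ?G * ennreal (mass i)" by simp
  then show "?G = 1"
    using i by (simp only: mult.commute[of _ "ennreal (mass i)"] ennreal_mult_cancel_left) auto
qed

lemma nn_integral_averaged_sym:
  assumes "P \<in> couplings S M M" "\<And>i j. h i j = h j i"
  shows "(\<integral>\<^sup>+z. lift h z \<partial>plan_measure (averaged_density P)) = (\<integral>\<^sup>+z. lift h z \<partial>P)"
proof (rule ennreal_double_cancel)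
  have "(\<integral>\<^sup>+z. lift (\<lambda>i j. h j i) z \<partial>P) = (\<integral>\<^sup>+z. lift h z \<partial>P)"
    by (rule nn_integral_cong, rule assms(2))
  then show "2 * (\<integral>\<^sup>+z. lift h z \<partial>plan_measure (averaged_density P)) =
      (\<integral>\<^sup>+z. lift h z \<partial>P) + (\<integral>\<^sup>+z. lift h z \<partial>P)"
    using nn_integral_averaged[OF assms(1), of h] by (simp only:)
qed

text \<open>Integrability and the integral are read off from the nonnegative integrals of the norm,
  of \<open>h\<close> and of \<open>- h\<close>, each of which is a symmetric function of the
  labels.\<close>

lemma integral_averaged_sym:
  fixes h :: "'l \<Rightarrow> 'l \<Rightarrow> real"
  assumes "P \<in> couplings S M M" "\<And>i j. h i j = h j i"
    and int: "integrable (plan_measure (averaged_density P)) (\<lambda>z. lift h z)"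
  shows "integrable P (\<lambda>z. lift h z)"
    "(\<integral>z. lift h z \<partial>P) = (\<integral>z. lift h z \<partial>plan_measure (averaged_density P))"
proof -
  let ?Q = "plan_measure (averaged_density P)"
  have [measurable_cong]: "sets P = sets product" by (rule couplingD(2)[OF assms(1)])
  have m: "(\<lambda>z. lift h z) \<in> borel_measurable P" by measurable
  have eq: "(\<integral>\<^sup>+z. ennreal (f (lift h z)) \<partial>P) = (\<integral>\<^sup>+z. ennreal (f (lift h z)) \<partial>?Q)" for f :: "real \<Rightarrow> real"
    by (rule nn_integral_averaged_sym[OF assms(1), of "\<lambda>i j. ennreal (f (h i j))", symmetric])
      (simp add: assms(2)[of _ "l _"] assms(2))
  show i: "integrable P (\<lambda>z. lift h z)"
    unfolding integrable_iff_bounded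
    using int[unfolded integrable_iff_bounded] m by (simp add: eq)
  show "(\<integral>z. lift h z \<partial>P) = (\<integral>z. lift h z \<partial>?Q)"
    using eq[of "\<lambda>x. x"] eq[of uminus] by (simp add: real_lebesgue_integral_def[OF i] real_lebesgue_integral_def[OF int])
qed

text \<open>Let \<open>F\<close> and \<open>G\<close> be the entropies of \<open>P\<close> and of
  its average. The costs agree, so optimality gives \<open>F \<le> G\<close>, while Gibbs'
  inequality relative to the average gives \<open>G \<le> F\<close>. Its equality case shows that
  \<open>P\<close> is its own average.\<close>

lemma minimiser_plan:
  assumes min: "is_entropic_minimiser S (\<lambda>x y. c (l x) (l y)) M \<epsilon> P" and \<epsilon>: "0 < \<epsilon>"
  obtains g where "plan g" "P = plan_measure g" "integrable product (\<lambda>z. lift c z * lift g z)"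
    "(\<integral>z. lift c z * lift g z \<partial>product) \<le> \<epsilon> * label_entropy"
    "\<And>g'. plan g' \<Longrightarrow> integrable product (\<lambda>z. lift c z * lift g' z) \<Longrightarrow> plan_value \<epsilon> g \<le> plan_value \<epsilon> g'"
proof -
  let ?c = "\<lambda>x y. c (l x) (l y)"
  have P: "P \<in> couplings S M M"
    and opt: "\<And>Q. Q \<in> couplings S M M \<Longrightarrow> entropic_cost ?c M \<epsilon> P \<le> entropic_cost ?c M \<epsilon> Q"
    using min by (auto simp: is_entropic_minimiser_def)
  note PD = couplingD[OF P]
  interpret P: prob_space P by (rule PD(1))
  define K where "K = (\<integral>\<^sup>+(x, y). ennreal (?c x y) \<partial>P)"
  have cost_P: "entropic_cost ?c M \<epsilon> P = enn2ereal K + ereal \<epsilon> * KL P product"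
    by (simp add: entropic_cost_def K_def)
  have opt_plan: "entropic_cost ?c M \<epsilon> P \<le> ereal (plan_value \<epsilon> g)"
    if "plan g" "integrable product (\<lambda>z. lift c z * lift g z)" for g
    using opt[OF plan_coupling[OF that(1)]] by (simp add: entropic_cost_plan[OF that])
  \<comment> \<open>Comparison with the diagonal plan makes both terms for \<open>P\<close> finite;
    since the entropy is nonnegative it also bounds the cost alone.\<close>
  have le: "enn2ereal K + ereal \<epsilon> * KL P product \<le> ereal (\<epsilon> * label_entropy)"
    using opt_plan[OF plan_diagonal plan_value_diagonal(1)] by (simp add: cost_P plan_value_diagonal)
  have "KL P product \<noteq> \<infinity>"
  proof
    assume "KL P product = \<infinity>"
    with le \<epsilon> show False by (cases "enn2ereal K") auto
  qed
  from KL_finite_density[OF pair.prob_space_axioms PD(1,2) this]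
  obtain f where f [measurable]: "f \<in> borel_measurable product" and f_nn: "\<And>z. 0 \<le> f z"
    and Pf: "P = density product (\<lambda>z. ennreal (f z))"
    and f_int: "integrable product (\<lambda>z. f z * ln (f z))"
    and KLf: "KL P product = ereal (\<integral>z. f z * ln (f z) \<partial>product)"
    by blast
  define F where "F = (\<integral>z. f z * ln (f z) \<partial>product)"
  have prob_density: "integrable product h \<and> (\<integral>z. h z \<partial>product) = 1"
    if [measurable]: "h \<in> borel_measurable product" and nn: "\<And>z. 0 \<le> h z"
      and pr: "prob_space (density product (\<lambda>z. ennreal (h z)))" for h :: "'a \<times> 'a \<Rightarrow> real"
  proof -
    have "emeasure (density product (\<lambda>z. ennreal (h z))) (space product) = 1"
      using prob_space.emeasure_space_1[OF pr] by simp
    then have "(\<integral>\<^sup>+z. ennreal (h z) \<partial>product) = 1"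
      by (simp add: emeasure_density cong: nn_integral_cong)
    then have "has_bochner_integral product h 1"
      by (intro has_bochner_integral_nn_integral) (auto simp: nn)
    then show ?thesis by (simp add: has_bochner_integral_iff)
  qed
  have f1: "integrable product f" "(\<integral>z. f z \<partial>product) = 1"
    using prob_density[OF f f_nn] PD(1) by (simp_all add: Pf)
  have F_nn: "0 \<le> F"
  proof -
    have "(\<integral>z. f z - 1 \<partial>product) \<le> F"
      unfolding F_def using f1(1) f_int xlnx_ge[OF f_nn] by (intro integral_mono) auto
    then show ?thesis using f1 by (simp add: pair.prob_space)
  qed
  have "K \<noteq> top"
  proof
    assume "K = top"
    with le show False by (simp add: KLf)
  qed
  then obtain k where k: "0 \<le> k" "K = ennreal k" by (cases K) auto
  have kF: "k + \<epsilon> * F \<le> \<epsilon> * label_entropy"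
    using le k by (simp add: KLf F_def)
  let ?g = "averaged_density P"
  let ?Q = "plan_measure ?g"
  have plan: "plan ?g" by (rule plan_averaged[OF P])
  have g_nn: "0 \<le> lift ?g z" for z by (rule planD(1)[OF plan])
  have g_meas [measurable]: "(\<lambda>z. lift ?g z) \<in> borel_measurable product" by (rule lift_borel)
  have "(\<integral>\<^sup>+z. ennreal (lift c z * lift ?g z) \<partial>product) = ennreal k"
    using nn_integral_averaged_sym[OF P, of "\<lambda>i j. ennreal (c i j)"] nn_cost_plan[OF plan] k(2)
    by (simp add: K_def case_prod_beta' c_sym)
  then have "has_bochner_integral product (\<lambda>z. lift c z * lift ?g z) k"
    by (intro has_bochner_integral_nn_integral) (auto simp: g_nn c_nonneg k(1))
  then have gc: "integrable product (\<lambda>z. lift c z * lift ?g z)" "(\<integral>z. lift c z * lift ?g z \<partial>product) = k"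
    by (simp_all add: has_bochner_integral_iff)
  define G where "G = (\<integral>z. lift ?g z * ln (lift ?g z) \<partial>product)"
  have "ereal (k + \<epsilon> * F) \<le> ereal (k + \<epsilon> * G)"
    using opt_plan[OF plan gc(1)] k by (simp add: cost_P KLf F_def plan_value_def gc(2) G_def)
  then have FG: "F \<le> G" using \<epsilon> by simp
  have ent: "integrable product (\<lambda>z. lift ?g z * ln (lift ?g z))" by (rule plan_entropy[OF plan])
  then have "integrable ?Q (\<lambda>z. ln (lift ?g z))"
    by (subst integrable_real_density) (auto simp: g_nn)
  \<comment> \<open>The logarithm of the averaged density is itself a symmetric function of the
    labels, so \<open>P\<close> and its average integrate it alike. This identifies the cross
    entropy with \<open>G\<close>.\<close>
  from integral_averaged_sym[OF P _ this]
  have lnP: "integrable P (\<lambda>z. ln (lift ?g z))" "(\<integral>z. ln (lift ?g z) \<partial>P) = (\<integral>z. ln (lift ?g z) \<partial>?Q)"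
    using planD(2)[OF plan] by metis+
  have fg: "integrable product (\<lambda>z. f z * ln (lift ?g z))"
    using lnP(1) unfolding Pf by (subst (asm) integrable_real_density) (auto simp: f_nn Pf[symmetric])
  have "(\<integral>z. f z * ln (lift ?g z) \<partial>product) = (\<integral>z. ln (lift ?g z) \<partial>density product (\<lambda>z. ennreal (f z)))"
    by (rule integral_real_density[symmetric]) (auto simp: f_nn)
  also have "\<dots> = (\<integral>z. ln (lift ?g z) \<partial>?Q)"
    using lnP(2) by (simp add: Pf[symmetric])
  also have "\<dots> = G"
    unfolding G_def by (rule integral_real_density) (auto simp: g_nn)
  finally have fG: "(\<integral>z. f z * ln (lift ?g z) \<partial>product) = G" .
  have g1: "integrable product (\<lambda>z. lift ?g z)" "(\<integral>z. lift ?g z \<partial>product) = 1"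
    using prob_density[OF g_meas g_nn plan_prob_space[OF plan]] by simp_all
  \<comment> \<open>The zero set of the averaged density is a symmetric union of cells and is null
    for the average, hence null for \<open>P\<close>. This is the absolute continuity that
    \<open>gibbs_pointwise\<close> asks for.\<close>
  have "(\<integral>\<^sup>+z. lift (\<lambda>i j. indicator {0} (?g i j)) z \<partial>P) =
      (\<integral>\<^sup>+z. lift (\<lambda>i j. indicator {0} (?g i j)) z \<partial>?Q)"
    by (rule nn_integral_averaged_sym[OF P, symmetric]) (simp add: planD(2)[OF plan, of _ "_ :: 'l"])
  also have "\<dots> = (\<integral>\<^sup>+z. ennreal (lift ?g z) * lift (\<lambda>i j. indicator {0} (?g i j)) z \<partial>product)"
    by (rule nn_integral_density) auto
  also have "\<dots> = (\<integral>\<^sup>+z. 0 \<partial>product)"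
    by (intro nn_integral_cong) (auto simp: indicator_def)
  finally have "(\<integral>\<^sup>+z. ennreal (f z) * lift (\<lambda>i j. indicator {0} (?g i j)) z \<partial>product) = 0"
    by (simp add: Pf nn_integral_density)
  then have "AE z in product. ennreal (f z) * lift (\<lambda>i j. indicator {0} (?g i j)) z = 0"
    by (subst (asm) nn_integral_0_iff_AE) auto
  then have ac: "AE z in product. lift ?g z = 0 \<longrightarrow> f z = 0"
    by eventually_elim (use f_nn in \<open>auto simp: indicator_def ennreal_eq_0_iff antisym\<close>)
  \<comment> \<open>Both densities integrate to 1, so the first two terms cancel and
    \<open>D\<close> has integral \<open>F - G\<close>.\<close>
  define D where "D z = lift ?g z - f z + f z * ln (f z) - f z * ln (lift ?g z)" for z
  have D_int: "integrable product D"
    unfolding D_def[abs_def] by (intro Bochner_Integration.integrable_add Bochner_Integration.integrable_diff g1 f1 f_int fg)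
  have D_nn: "AE z in product. 0 \<le> D z"
    using ac
  proof eventually_elim
    case (elim z)
    then show ?case unfolding D_def by (intro gibbs_pointwise(1) f_nn g_nn) simp
  qed
  have "(\<integral>z. D z \<partial>product) = F - G"
    unfolding D_def using g1 f1 f_int fg by (simp add: fG F_def)
  moreover have "0 \<le> (\<integral>z. D z \<partial>product)" by (rule integral_nonneg_AE[OF D_nn])
  ultimately have "(\<integral>z. D z \<partial>product) = 0" using FG by simp
  then have "AE z in product. D z = 0"
    by (simp add: integral_nonneg_eq_0_iff_AE[OF D_int D_nn])
  with ac have "AE z in product. f z = lift ?g z"
  proof eventually_elim
    case (elim z)
    show ?case
      by (rule gibbs_pointwise(2)[OF f_nn g_nn]) (use elim in \<open>simp_all add: D_def\<close>)
  qed
  then have "P = ?Q"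
    unfolding Pf by (intro density_cong) (auto simp: Pf[symmetric])
  moreover have "k \<le> \<epsilon> * label_entropy"
    using kF mult_nonneg_nonneg[of \<epsilon> F] \<epsilon> F_nn by linarith
  moreover have "plan_value \<epsilon> ?g \<le> plan_value \<epsilon> g'"
    if "plan g'" "integrable product (\<lambda>z. lift c z * lift g' z)" for g'
    using opt_plan[OF that] entropic_cost_plan[OF plan gc(1), of \<epsilon>] \<open>P = ?Q\<close> by (metis ereal_less_eq(3))
  ultimately show ?thesis
    using that[OF plan _ gc(1)] gc(2) by simp
qed

section \<open>Perturbation on two labels and the four-point identity\<close>

lemma integral_lift_two_labels:
  fixes d :: "'l \<Rightarrow> 'l \<Rightarrow> real"
  assumes ij: "i \<noteq> j" and d: "\<And>p q. p \<notin> {i, j} \<or> q \<notin> {i, j} \<Longrightarrow> d p q = 0"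
  shows "integrable product (\<lambda>z. lift d z)"
    "(\<integral>z. lift d z \<partial>product) = d i i * (mass i * mass i) + d i j * (mass i * mass j) +
      d j i * (mass j * mass i) + d j j * (mass j * mass j)"
proof -
  let ?C = "\<lambda>p q. {z \<in> space product. l (fst z) = p \<and> l (snd z) = q}"
  have C: "has_bochner_integral product (\<lambda>z. d p q * indicator (?C p q) z) (d p q * (mass p * mass q))" for p q
  proof -
    have "measure product (?C p q) = mass p * mass q"
      by (simp add: measure_def emeasure_product_label)
    then have "has_bochner_integral product (indicator (?C p q)) (mass p * mass q)"
      using has_bochner_integral_real_indicator[of "?C p q" product] label_pair_set[of p q]
      by (simp add: emeasure_product_label)
    then show ?thesis by (rule has_bochner_integral_mult_right)
  qed
  have eq: "lift d z = d i i * indicator (?C i i) z + d i j * indicator (?C i j) z +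
      d j i * indicator (?C j i) z + d j j * indicator (?C j j) z" if "z \<in> space product" for z
    using that ij d[of "l (fst z)" "l (snd z)"] by (auto simp: indicator_def)
  have "has_bochner_integral product (\<lambda>z. lift d z) (d i i * (mass i * mass i) + d i j * (mass i * mass j) +
      d j i * (mass j * mass i) + d j j * (mass j * mass j))"
    by (rule has_bochner_integral_cong[THEN iffD2, OF refl eq refl])
      (auto intro!: has_bochner_integral_add C)
  then show "integrable product (\<lambda>z. lift d z)"
    "(\<integral>z. lift d z \<partial>product) = d i i * (mass i * mass i) + d i j * (mass i * mass j) +
      d j i * (mass j * mass i) + d j j * (mass j * mass j)"
    by (simp_all add: has_bochner_integral_iff)
qed

text \<open>\<open>swap_direction i j\<close> has mean 0, so adding multiples of its tensor square keeps both marginals.\<close>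

definition swap_direction :: "'l \<Rightarrow> 'l \<Rightarrow> 'l \<Rightarrow> real" where
  "swap_direction i j p = (if p = i then 1 / mass i else if p = j then - 1 / mass j else 0)"

text \<open>For \<open>i \<noteq> j\<close> of positive mass, \<open>t\<close> is the amount of mass
  added to each of the cells \<open>(i, i)\<close> and \<open>(j, j)\<close> and taken from each of
  \<open>(i, j)\<close> and \<open>(j, i)\<close>.\<close>

definition perturbed :: "('l \<Rightarrow> 'l \<Rightarrow> real) \<Rightarrow> 'l \<Rightarrow> 'l \<Rightarrow> real \<Rightarrow> 'l \<Rightarrow> 'l \<Rightarrow> real" where
  "perturbed g i j t p q = g p q + t * (swap_direction i j p * swap_direction i j q)"

lemma integral_swap_direction:
  assumes "i \<noteq> j" "0 < mass i" "0 < mass j"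
  shows "integrable M (\<lambda>x. swap_direction i j (l x))" "(\<integral>x. swap_direction i j (l x) \<partial>M) = 0"
proof -
  let ?C = "\<lambda>p. {x \<in> space M. l x = p}"
  have C: "has_bochner_integral M (\<lambda>x. a * indicator (?C p) x) (a * mass p)" for a p
    unfolding mass_def
    by (intro has_bochner_integral_mult_right has_bochner_integral_real_indicator)
      (auto simp: emeasure_label)
  have "has_bochner_integral M (\<lambda>x. 1 / mass i * indicator (?C i) x + (- 1 / mass j) * indicator (?C j) x)
      (1 / mass i * mass i + (- 1 / mass j) * mass j)"
    by (intro has_bochner_integral_add C)
  also have "?this \<longleftrightarrow> has_bochner_integral M (\<lambda>x. swap_direction i j (l x))
      (1 / mass i * mass i + (- 1 / mass j) * mass j)"
    by (rule has_bochner_integral_cong)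
      (use assms(1) in \<open>auto simp: swap_direction_def indicator_def\<close>)
  finally have "has_bochner_integral M (\<lambda>x. swap_direction i j (l x)) (1 / mass i * mass i + (- 1 / mass j) * mass j)" .
  then show "integrable M (\<lambda>x. swap_direction i j (l x))" "(\<integral>x. swap_direction i j (l x) \<partial>M) = 0"
    using assms(2,3) by (simp_all add: has_bochner_integral_iff)
qed

lemma plan_perturbed:
  assumes g: "plan g" and ij: "i \<noteq> j" "0 < mass i" "0 < mass j"
    and nn: "\<And>p q. 0 \<le> perturbed g i j t p q"
  shows "plan (perturbed g i j t)"
  unfolding plan_def
proof (intro conjI allI impI)
  show "perturbed g i j t p q = perturbed g i j t q p" for p q
    by (simp add: perturbed_def planD(2)[OF g, of p q] mult.commute)
  fix p assume p: "0 < mass p"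
  have "has_bochner_integral M (\<lambda>y. g p (l y)) 1"
    by (intro has_bochner_integral_nn_integral) (auto simp: planD(1)[OF g] planD(3)[OF g p])
  then have 1: "has_bochner_integral M (\<lambda>y. perturbed g i j t p (l y)) (1 + t * (swap_direction i j p * 0))"
    unfolding perturbed_def
    by (intro has_bochner_integral_add has_bochner_integral_mult_right)
      (use integral_swap_direction[OF ij] in \<open>auto simp: has_bochner_integral_iff\<close>)
  then have "(\<integral>\<^sup>+y. ennreal (perturbed g i j t p (l y)) \<partial>M) = ennreal (\<integral>y. perturbed g i j t p (l y) \<partial>M)"
    by (intro nn_integral_eq_integral) (auto simp: has_bochner_integral_iff nn)
  with 1 show "(\<integral>\<^sup>+y. ennreal (perturbed g i j t p (l y)) \<partial>M) = 1"
    by (simp add: has_bochner_integral_iff)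
qed (rule nn)

text \<open>The move changes the cost by \<open>- 2 * c i j * t\<close>, and
  \<open>xlnx_diff_le\<close> bounds the change of entropy cell by cell, with logarithms of the new
  densities. Optimality makes the total change nonnegative. The sign of \<open>t\<close> is free, so
  the common factor \<open>t\<close> is kept.\<close>

lemma perturbation_inequality:
  assumes g: "plan g" and ij: "i \<noteq> j" "0 < mass i" "0 < mass j"
    and int: "integrable product (\<lambda>z. lift c z * lift g z)" and \<epsilon>: "0 < \<epsilon>"
    and opt: "\<And>g'. plan g' \<Longrightarrow> integrable product (\<lambda>z. lift c z * lift g' z) \<Longrightarrow> plan_value \<epsilon> g \<le> plan_value \<epsilon> g'"
    and pos: "0 < perturbed g i j t i i" "0 < perturbed g i j t i j" "0 < perturbed g i j t j j"
  shows "2 * c i j * t \<le> \<epsilon> * (t * (ln (perturbed g i j t i i) + ln (perturbed g i j t j j) - 2 * ln (perturbed g i j t i j)))"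
proof -
  let ?g = "perturbed g i j t"
  let ?s = "\<lambda>p q. swap_direction i j p * swap_direction i j q"
  have sym: "?g j i = ?g i j" by (simp add: perturbed_def planD(2)[OF g, of j i] mult.commute)
  have out: "?g p q = g p q" if "p \<notin> {i, j} \<or> q \<notin> {i, j}" for p q
    using that by (auto simp: perturbed_def swap_direction_def)
  have nn: "0 \<le> ?g p q" for p q
  proof (cases "p \<in> {i, j} \<and> q \<in> {i, j}")
    case True
    then show ?thesis using pos sym by auto
  next
    case False
    then show ?thesis using out[of p q] planD(1)[OF g] by auto
  qed
  have plan: "plan ?g" by (rule plan_perturbed[OF g ij nn])
  have at: "?s i i * (mass i * mass i) = 1" "?s j j * (mass j * mass j) = 1"
    "?s i j * (mass i * mass j) = - 1" "?s j i * (mass j * mass i) = - 1"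
    using ij by (simp_all add: swap_direction_def)
  let ?d1 = "\<lambda>p q. c p q * (t * ?s p q)"
  have z1: "?d1 p q = 0" if "p \<notin> {i, j} \<or> q \<notin> {i, j}" for p q
    using that by (auto simp: swap_direction_def)
  note I1 = integral_lift_two_labels[where d = ?d1, OF ij(1) z1]
  have "?d1 i i * (mass i * mass i) + ?d1 i j * (mass i * mass j) + ?d1 j i * (mass j * mass i) + ?d1 j j * (mass j * mass j)
      = c i i * t * (?s i i * (mass i * mass i)) + c i j * t * (?s i j * (mass i * mass j)) +
        c j i * t * (?s j i * (mass j * mass i)) + c j j * t * (?s j j * (mass j * mass j))"
    by (simp add: mult_ac)
  also have "\<dots> = - 2 * c i j * t"
    unfolding at by (simp add: c_diag c_sym[of j i])
  finally have I1': "(\<integral>z. lift ?d1 z \<partial>product) = - 2 * c i j * t"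
    using I1(2) by simp
  have cg: "lift c z * lift ?g z = lift c z * lift g z + lift ?d1 z" for z
    by (simp add: perturbed_def distrib_left)
  have int': "integrable product (\<lambda>z. lift c z * lift ?g z)"
    unfolding cg by (intro Bochner_Integration.integrable_add int I1(1))
  have cost: "(\<integral>z. lift c z * lift ?g z \<partial>product) = (\<integral>z. lift c z * lift g z \<partial>product) - 2 * c i j * t"
    unfolding cg using int I1(1) I1' by simp
  let ?d2 = "\<lambda>p q. ?g p q * ln (?g p q) - g p q * ln (g p q)"
  have z2: "?d2 p q = 0" if "p \<notin> {i, j} \<or> q \<notin> {i, j}" for p q
    using out[OF that] by simp
  note I2 = integral_lift_two_labels[where d = ?d2, OF ij(1) z2]
  have bound: "?d2 p q * (mass p * mass q) \<le> t * (?s p q * (mass p * mass q)) * (ln (?g p q) + 1)"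
    if "0 < ?g p q" for p q
  proof -
    have "?d2 p q \<le> (?g p q - g p q) * (ln (?g p q) + 1)"
      by (rule xlnx_diff_le[OF planD(1)[OF g] that])
    then have "?d2 p q * (mass p * mass q) \<le> (?g p q - g p q) * (ln (?g p q) + 1) * (mass p * mass q)"
      by (intro mult_right_mono) auto
    also have "?g p q - g p q = t * ?s p q" by (simp add: perturbed_def)
    finally show ?thesis by (simp add: mult_ac)
  qed
  have "(\<integral>z. lift ?d2 z \<partial>product) \<le> t * (ln (?g i i) + 1) - t * (ln (?g i j) + 1) - t * (ln (?g j i) + 1) + t * (ln (?g j j) + 1)"
    using bound[of i i] bound[of i j] bound[of j i] bound[of j j] pos sym I2(2) by (simp add: at)
  also have "\<dots> = t * (ln (?g i i) + ln (?g j j) - 2 * ln (?g i j))"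
    by (simp add: sym algebra_simps)
  finally have ent: "(\<integral>z. lift ?d2 z \<partial>product) \<le> t * (ln (?g i i) + ln (?g j j) - 2 * ln (?g i j))" .
  have "(\<integral>z. lift ?d2 z \<partial>product) = (\<integral>z. lift ?g z * ln (lift ?g z) \<partial>product) - (\<integral>z. lift g z * ln (lift g z) \<partial>product)"
    using plan_entropy[OF g] plan_entropy[OF plan] by (rule Bochner_Integration.integral_diff[OF _ _, rotated])
  with opt[OF plan int'] cost
  have "2 * c i j * t \<le> \<epsilon> * (\<integral>z. lift ?d2 z \<partial>product)"
    by (simp add: plan_value_def right_diff_distrib)
  also have "\<dots> \<le> \<epsilon> * (t * (ln (?g i i) + ln (?g j j) - 2 * ln (?g i j)))"
    using ent \<epsilon> by (intro mult_left_mono) auto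
  finally show ?thesis .
qed

text \<open>Positive \<open>t\<close> gives one inequality and negative \<open>t\<close> the other.
  Each is exponentiated before \<open>t\<close> tends to 0, because the products converge even where
  a density tends to 0. If there is no mass to move in the required direction, the side claimed to
  be smaller is 0.\<close>

lemma four_point_identity:
  assumes g: "plan g" and ij: "i \<noteq> j" "0 < mass i" "0 < mass j"
    and int: "integrable product (\<lambda>z. lift c z * lift g z)" and \<epsilon>: "0 < \<epsilon>"
    and opt: "\<And>g'. plan g' \<Longrightarrow> integrable product (\<lambda>z. lift c z * lift g' z) \<Longrightarrow> plan_value \<epsilon> g \<le> plan_value \<epsilon> g'"
  shows "(g i j)\<^sup>2 * exp (2 * c i j / \<epsilon>) = g i i * g j j"
proof -
  let ?g = "perturbed g i j"
  let ?e = "exp (2 * c i j / \<epsilon>)"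
  have ineq: "2 * c i j * t \<le> \<epsilon> * (t * (ln (?g t i i) + ln (?g t j j) - 2 * ln (?g t i j)))"
    if "0 < ?g t i i" "0 < ?g t i j" "0 < ?g t j j" for t
    by (rule perturbation_inequality[OF g ij int \<epsilon> _ that]) (rule opt)
  note nn = planD(1)[OF g]
  have p: "?g t i i = g i i + t / (mass i)\<^sup>2" "?g t j j = g j j + t / (mass j)\<^sup>2"
    "?g t i j = g i j - t / (mass i * mass j)" for t
    using ij(1) by (simp_all add: perturbed_def swap_direction_def power2_eq_square)
  have "((\<lambda>t. (?g t i j)\<^sup>2 * ?e) \<longlongrightarrow> (g i j - 0 / (mass i * mass j))\<^sup>2 * ?e) (at 0 within A)"
    "((\<lambda>t. ?g t i i * ?g t j j) \<longlongrightarrow> (g i i + 0 / (mass i)\<^sup>2) * (g j j + 0 / (mass j)\<^sup>2)) (at 0 within A)" for A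
    unfolding p by (intro tendsto_intros; use ij in simp)+
  then have conv: "((\<lambda>t. (?g t i j)\<^sup>2 * ?e) \<longlongrightarrow> (g i j)\<^sup>2 * ?e) (at 0 within A)"
    "((\<lambda>t. ?g t i i * ?g t j j) \<longlongrightarrow> g i i * g j j) (at 0 within A)" for A
    by simp_all
  have expand: "ln (x\<^sup>2 * ?e) = 2 * ln x + 2 * c i j / \<epsilon>" "ln (y * z) = ln y + ln z"
    if "0 < x" "0 < y" "0 < z" for x y z :: real
    using that by (simp_all add: ln_mult ln_realpow)
  show ?thesis
  proof (rule antisym)
    show "(g i j)\<^sup>2 * ?e \<le> g i i * g j j"
    proof (cases "g i j = 0")
      case True
      then show ?thesis using nn by simp
    next
      case False
      then have pos: "0 < g i j" using nn[of i j] by simp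
      have "\<forall>\<^sub>F t in at_right 0. (?g t i j)\<^sup>2 * ?e \<le> ?g t i i * ?g t j j"
        unfolding eventually_at_right_field
      proof (intro exI[of _ "g i j * (mass i * mass j)"] conjI allI impI)
        show "0 < g i j * (mass i * mass j)" using pos ij by simp
        fix t assume t: "0 < t" "t < g i j * (mass i * mass j)"
        have pt: "0 < ?g t i i" "0 < ?g t i j" "0 < ?g t j j"
        proof -
          have "0 < t / (mass i)\<^sup>2" "0 < t / (mass j)\<^sup>2" using t ij by simp_all
          moreover have "t / (mass i * mass j) < g i j" using t ij by (simp add: pos_divide_less_eq)
          ultimately show "0 < ?g t i i" "0 < ?g t i j" "0 < ?g t j j"
            unfolding p using nn[of i i] nn[of j j] by linarith+
        qed
        have "t * (2 * c i j) \<le> t * (\<epsilon> * (ln (?g t i i) + ln (?g t j j) - 2 * ln (?g t i j)))"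
          using ineq[OF pt] by (simp add: mult_ac)
        then have "2 * c i j / \<epsilon> \<le> ln (?g t i i) + ln (?g t j j) - 2 * ln (?g t i j)"
          using t(1) \<epsilon> by (simp only: mult_le_cancel_left_pos pos_divide_le_eq mult.commute[of _ \<epsilon>])
        then have "ln ((?g t i j)\<^sup>2 * ?e) \<le> ln (?g t i i * ?g t j j)"
          using expand[OF pt(2,1,3)] by linarith
        then show "(?g t i j)\<^sup>2 * ?e \<le> ?g t i i * ?g t j j"
          using pt by (subst (asm) ln_le_cancel_iff) auto
      qed
      then show ?thesis
        by (rule tendsto_le[OF _ conv(2) conv(1), rotated]) simp
    qed
    show "g i i * g j j \<le> (g i j)\<^sup>2 * ?e"
    proof (cases "g i i = 0 \<or> g j j = 0")
      case True
      then show ?thesis by auto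
    next
      case False
      then have pos: "0 < g i i" "0 < g j j" using nn[of i i] nn[of j j] by auto
      \<comment> \<open>The smaller of the masses of the two diagonal cells; moving less than
        \<open>r\<close> keeps both densities positive.\<close>
      define r where "r = min (g i i * (mass i)\<^sup>2) (g j j * (mass j)\<^sup>2)"
      have "\<forall>\<^sub>F t in at_left 0. ?g t i i * ?g t j j \<le> (?g t i j)\<^sup>2 * ?e"
        unfolding eventually_at_left_field
      proof (intro exI[of _ "- r"] conjI allI impI)
        show "- r < 0" using pos ij by (simp add: r_def)
        fix t assume t: "- r < t" "t < 0"
        then have "- t < g i i * (mass i)\<^sup>2" "- t < g j j * (mass j)\<^sup>2" by (auto simp: r_def)
        then have pt: "0 < ?g t i i" "0 < ?g t i j" "0 < ?g t j j"
        proof -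
          assume "- t < g i i * (mass i)\<^sup>2" "- t < g j j * (mass j)\<^sup>2"
          then have "- t / (mass i)\<^sup>2 < g i i" "- t / (mass j)\<^sup>2 < g j j"
            using ij by (simp_all only: pos_divide_less_eq zero_less_power)
          moreover have "t / (mass i * mass j) < 0" using t ij by (simp add: divide_neg_pos)
          ultimately show "0 < ?g t i i" "0 < ?g t i j" "0 < ?g t j j"
            unfolding p using nn[of i j] by simp_all
        qed
        have "t * (\<epsilon> * (ln (?g t i i) + ln (?g t j j) - 2 * ln (?g t i j))) \<ge> t * (2 * c i j)"
          using ineq[OF pt] by (simp add: mult_ac)
        then have "ln (?g t i i) + ln (?g t j j) - 2 * ln (?g t i j) \<le> 2 * c i j / \<epsilon>"
          using t(2) \<epsilon> by (simp only: mult_le_cancel_left_neg pos_le_divide_eq mult.commute[of _ \<epsilon>])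
        then have "ln (?g t i i * ?g t j j) \<le> ln ((?g t i j)\<^sup>2 * ?e)"
          using expand[OF pt(2,1,3)] by linarith
        then show "?g t i i * ?g t j j \<le> (?g t i j)\<^sup>2 * ?e"
          using pt by (subst (asm) ln_le_cancel_iff) auto
      qed
      then show ?thesis
        by (rule tendsto_le[OF _ conv(1) conv(2), rotated]) simp
    qed
  qed
qed

section \<open>Cell masses of a minimiser\<close>

text \<open>Multiplying the density identity by the squares of both label masses turns it into one
  for cell masses. The last bound is Markov's inequality for the cost, whose integral is at most
  \<epsilon> times the label entropy.\<close>

lemma minimiser_facts:
  assumes min: "is_entropic_minimiser S (\<lambda>x y. c (l x) (l y)) M \<epsilon> P" and \<epsilon>: "0 < \<epsilon>"
  shows "P \<in> couplings S M M"
    and "cell_mass P i j = cell_mass P j i"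
    and "i \<noteq> j \<Longrightarrow> (cell_mass P i j)\<^sup>2 * exp (2 * c i j / \<epsilon>) = cell_mass P i i * cell_mass P j j"
    and "0 < r \<Longrightarrow> measure P {z \<in> space product. r \<le> lift c z} \<le> \<epsilon> * label_entropy / r"
proof -
  show P: "P \<in> couplings S M M"
    using min by (simp add: is_entropic_minimiser_def)
  interpret P: prob_space P by (rule couplingD(1)[OF P])
  obtain g where g: "plan g" "P = plan_measure g" "integrable product (\<lambda>z. lift c z * lift g z)"
    and cost: "(\<integral>z. lift c z * lift g z \<partial>product) \<le> \<epsilon> * label_entropy"
    and opt: "\<And>g'. plan g' \<Longrightarrow> integrable product (\<lambda>z. lift c z * lift g' z) \<Longrightarrow> plan_value \<epsilon> g \<le> plan_value \<epsilon> g'"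
    by (rule minimiser_plan[OF min \<epsilon>]) blast
  have cm: "cell_mass P p q = g p q * (mass p * mass q)" for p q
    using emeasure_plan_cell[of g p q] planD(1)[OF g(1)]
    by (simp add: cell_mass_def measure_def g(2))
  show "cell_mass P i j = cell_mass P j i"
    by (simp add: cm planD(2)[OF g(1), of i j] mult.commute)
  show "(cell_mass P i j)\<^sup>2 * exp (2 * c i j / \<epsilon>) = cell_mass P i i * cell_mass P j j" if ij: "i \<noteq> j"
  proof (cases "mass i = 0 \<or> mass j = 0")
    case True
    then show ?thesis by (auto simp: cm)
  next
    case False
    then have "0 < mass i" "0 < mass j" using mass_nonneg[of i] mass_nonneg[of j] by linarith+
    from four_point_identity[OF g(1) ij this g(3) \<epsilon> opt]
    have "(g i j)\<^sup>2 * exp (2 * c i j / \<epsilon>) = g i i * g j j" by blast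
    then have "(g i j)\<^sup>2 * exp (2 * c i j / \<epsilon>) * ((mass i)\<^sup>2 * (mass j)\<^sup>2) = g i i * g j j * ((mass i)\<^sup>2 * (mass j)\<^sup>2)"
      by simp
    then show ?thesis unfolding cm by (simp add: power2_eq_square mult_ac)
  qed
  assume r: "0 < r"
  let ?A = "{z \<in> space product. r \<le> lift c z}"
  have c_meas [measurable]: "(\<lambda>z. lift c z) \<in> borel_measurable product" by (rule lift_borel)
  have A [measurable]: "?A \<in> sets product" by measurable
  have "ennreal r * emeasure P ?A = (\<integral>\<^sup>+z. ennreal r * indicator ?A z \<partial>P)"
    by (subst nn_integral_cmult_indicator) (simp_all add: couplingD(2)[OF P] A)
  also have "\<dots> \<le> (\<integral>\<^sup>+z. ennreal (lift c z) \<partial>P)"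
    by (intro nn_integral_mono) (auto simp: indicator_def intro!: ennreal_leI)
  also have "\<dots> = (\<integral>\<^sup>+z. ennreal (lift c z * lift g z) \<partial>product)"
    using nn_cost_plan[OF g(1)] by (simp add: g(2) case_prod_beta')
  also have "\<dots> = ennreal (\<integral>z. lift c z * lift g z \<partial>product)"
    by (rule nn_integral_eq_integral[OF g(3)]) (simp add: c_nonneg planD(1)[OF g(1)])
  also have "\<dots> \<le> ennreal (\<epsilon> * label_entropy)"
    by (rule ennreal_leI[OF cost])
  finally have "ennreal (r * measure P ?A) \<le> ennreal (\<epsilon> * label_entropy)"
    using r by (simp add: ennreal_mult P.emeasure_eq_measure)
  moreover have "0 \<le> \<epsilon> * label_entropy"
  proof -
    have "0 \<le> (\<integral>z. lift c z * lift g z \<partial>product)"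
      by (simp add: c_nonneg planD(1)[OF g(1)])
    then show ?thesis using cost by linarith
  qed
  ultimately have "r * measure P ?A \<le> \<epsilon> * label_entropy" by simp
  then show "measure P ?A \<le> \<epsilon> * label_entropy / r"
    using r by (simp add: pos_le_divide_eq mult.commute)
qed

text \<open>Bound the diagonal masses in the four-point identity by 1 and take the square
  root.\<close>

lemma off_diagonal_small:
  assumes min: "is_entropic_minimiser S (\<lambda>x y. c (l x) (l y)) M \<epsilon> P" and \<epsilon>: "0 < \<epsilon>" and ij: "i \<noteq> j"
  shows "cell_mass P i j \<le> exp (- c i j / \<epsilon>)"
proof -
  note facts = minimiser_facts[OF min \<epsilon>]
  note b = cell_mass_bounds[OF facts(1)]
  have le1: "cell_mass P p p \<le> 1" for p using b(2)[of p p] mass_le_1[of p] by simp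
  have "(cell_mass P i j)\<^sup>2 * exp (2 * c i j / \<epsilon>) \<le> 1"
    unfolding facts(3)[OF ij] using le1[of i] le1[of j] b(1) by (intro mult_le_one)
  also have "exp (2 * c i j / \<epsilon>) = (exp (c i j / \<epsilon>))\<^sup>2"
    by (simp add: exp_double[symmetric])
  finally have "(cell_mass P i j * exp (c i j / \<epsilon>))\<^sup>2 \<le> 1\<^sup>2"
    by (simp add: power_mult_distrib)
  then have "cell_mass P i j * exp (c i j / \<epsilon>) \<le> 1"
    by (rule power2_le_imp_le) simp
  then show ?thesis by (simp add: exp_minus field_simps)
qed

text \<open>Think of \<open>A\<close> as the nonzero indices of a block of weight \<open>W\<close>,
  of \<open>h\<close> as its index 0 and of \<open>L\<close> as the price of leaving it. The
  diagonal mass \<open>D\<close> and the off-diagonal mass \<open>Off\<close> within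
  \<open>A\<close> together exceed \<open>W / 2\<close>. If \<open>D\<close> is at most
  \<open>W / 4\<close>, then \<open>Off\<close> is large; otherwise the four-point identity
  transfers a fixed fraction of \<open>D\<close> to the off-diagonal cells, there being enough of
  them to outweigh \<open>exp (- b / \<epsilon>)\<close>.\<close>

lemma block_off_diagonal_mass:
  assumes min: "is_entropic_minimiser S (\<lambda>x y. c (l x) (l y)) M \<epsilon> P" and \<epsilon>: "0 < \<epsilon>"
    and A: "finite A" "\<And>p. p \<in> A \<Longrightarrow> mass p = W / (real (card A) + 1)" "mass h = W / (real (card A) + 1)"
    and cost_in: "\<And>p q. p \<in> A \<Longrightarrow> q \<in> A \<Longrightarrow> p \<noteq> q \<Longrightarrow> c p q = b"
    and cost_out: "\<And>p x. p \<in> A \<Longrightarrow> x \<in> space M \<Longrightarrow> l x \<notin> insert h A \<Longrightarrow> L \<le> c p (l x)"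
    and L: "0 < L" "\<epsilon> * label_entropy / L \<le> W / 4" and W: "0 < W"
    and large: "7 \<le> card A" "exp (b / \<epsilon>) \<le> real (card A) + 1"
  shows "W / 32 \<le> measure P {z \<in> space product. l (fst z) \<in> A \<and> l (snd z) \<in> A \<and> l (fst z) \<noteq> l (snd z)}"
proof -
  note facts = minimiser_facts[OF min \<epsilon>]
  note b = cell_mass_bounds[OF facts(1)]
  note PD = couplingD[OF facts(1)]
  interpret P: prob_space P by (rule PD(1))
  let ?m = "cell_mass P"
  let ?C = "\<lambda>p q. {z \<in> space product. l (fst z) = p \<and> l (snd z) = q}"
  define N where "N = real (card A) + 1"
  define w where "w = W / N"
  have N: "8 \<le> N" using large(1) by (simp add: N_def)
  have w: "0 < w" using W N by (simp add: w_def)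
  have lab_sets: "{z \<in> space product. Q (l (fst z)) (l (snd z))} \<in> sets P" for Q
  proof -
    have "(\<lambda>z. lift Q z) \<in> product \<rightarrow>\<^sub>M count_space UNIV" by (rule lift_measurable) simp
    then show ?thesis unfolding PD(2) by (simp add: pred_def)
  qed
  define Off where "Off = measure P {z \<in> space product. l (fst z) \<in> A \<and> l (snd z) \<in> A \<and> l (fst z) \<noteq> l (snd z)}"
  define D where "D = (\<Sum>p\<in>A. ?m p p)"
  have cells: "measure P {z \<in> space product. (l (fst z), l (snd z)) \<in> I} = (\<Sum>(p, q)\<in>I. ?m p q)" if "finite I" for I
  proof -
    have "{z \<in> space product. (l (fst z), l (snd z)) \<in> I} = (\<Union>(p, q)\<in>I. ?C p q)" by auto
    also have "measure P \<dots> = (\<Sum>pq\<in>I. measure P (case pq of (p, q) \<Rightarrow> ?C p q))"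
      using that lab_sets
      by (intro P.finite_measure_finite_Union) (auto simp: disjoint_family_on_def)
    finally show ?thesis by (simp add: cell_mass_def case_prod_beta)
  qed
  have Off: "Off = (\<Sum>(p, q)\<in>{(p, q). p \<in> A \<and> q \<in> A \<and> p \<noteq> q}. ?m p q)"
  proof -
    have "finite {(p, q). p \<in> A \<and> q \<in> A \<and> p \<noteq> q}"
      by (rule finite_subset[of _ "A \<times> A"]) (use A(1) in auto)
    from cells[OF this] show ?thesis by (simp add: Off_def)
  qed
  have D: "D = measure P {z \<in> space product. l (fst z) \<in> A \<and> l (fst z) = l (snd z)}"
  proof -
    have fin: "finite ((\<lambda>p. (p, p)) ` A)" using A(1) by simp
    have "{z \<in> space product. (l (fst z), l (snd z)) \<in> (\<lambda>p. (p, p)) ` A} =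
        {z \<in> space product. l (fst z) \<in> A \<and> l (fst z) = l (snd z)}" by auto
    with cells[OF fin] show ?thesis
      by (simp add: D_def sum.reindex inj_on_def)
  qed
  let ?E1 = "{z \<in> space product. l (fst z) \<in> A \<and> l (fst z) = l (snd z)}"
  let ?E2 = "{z \<in> space product. l (fst z) \<in> A \<and> l (snd z) \<in> A \<and> l (fst z) \<noteq> l (snd z)}"
  let ?E3 = "{z \<in> space product. l (snd z) = h}"
  let ?E4 = "{z \<in> space product. L \<le> lift c z}"
  have E: "?E1 \<in> sets P" "?E2 \<in> sets P" "?E3 \<in> sets P" "?E4 \<in> sets P"
    using lab_sets[of "\<lambda>i j. i \<in> A \<and> i = j"] lab_sets[of "\<lambda>i j. i \<in> A \<and> j \<in> A \<and> i \<noteq> j"]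
      lab_sets[of "\<lambda>i j. j = h"] lab_sets[of "\<lambda>i j. L \<le> c i j"] by blast+
  have fst_w: "measure P {z \<in> space product. l (fst z) = p} = w" if "p \<in> A" for p
    using coupling_label_mass(1)[OF facts(1), of p] A(2)[OF that] w by (simp add: measure_def w_def N_def)
  have "w * real (card A) = (\<Sum>p\<in>A. measure P {z \<in> space product. l (fst z) = p})"
    by (simp add: fst_w mult.commute)
  also have "\<dots> = measure P (\<Union>p\<in>A. {z \<in> space product. l (fst z) = p})"
    using A(1) lab_sets[of "\<lambda>i j. i = _"]
    by (intro P.finite_measure_finite_Union[symmetric]) (auto simp: disjoint_family_on_def)
  \<comment> \<open>A pair starting in \<open>A\<close> is diagonal, or off-diagonal within
    \<open>A\<close>, or ends in \<open>h\<close>, or leaves the block at cost at least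
    \<open>L\<close>.\<close>
  also have "\<dots> \<le> measure P ((?E1 \<union> ?E2) \<union> (?E3 \<union> ?E4))"
  proof (rule P.finite_measure_mono)
    show "(\<Union>p\<in>A. {z \<in> space product. l (fst z) = p}) \<subseteq> (?E1 \<union> ?E2) \<union> (?E3 \<union> ?E4)"
    proof
      fix z assume "z \<in> (\<Union>p\<in>A. {z \<in> space product. l (fst z) = p})"
      then have z: "z \<in> space product" "l (fst z) \<in> A" by auto
      then have "snd z \<in> space M" by (simp add: space_pair_measure mem_Times_iff)
      with z cost_out[OF z(2) this] show "z \<in> (?E1 \<union> ?E2) \<union> (?E3 \<union> ?E4)" by auto
    qed
  qed (intro sets.Un E)
  also have "\<dots> \<le> (measure P ?E1 + measure P ?E2) + (measure P ?E3 + measure P ?E4)"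
    by (intro order_trans[OF measure_Un_le] add_mono sets.Un E order_refl)
  also have "\<dots> \<le> (D + Off) + (w + \<epsilon> * label_entropy / L)"
  proof -
    have "measure P ?E3 = w"
      using coupling_label_mass(2)[OF facts(1), of h] A(3) w by (simp add: measure_def w_def N_def)
    then show ?thesis
      using facts(4)[OF L(1)] by (simp add: D Off_def)
  qed
  finally have total: "w * real (card A) \<le> D + Off + w + W / 4"
    using L(2) by linarith
  \<comment> \<open>Here \<open>w * card A = W - w\<close>. Subtracting a further \<open>w\<close>
    for \<open>h\<close> and \<open>W / 4\<close> for the pairs that leave still leaves
    \<open>W / 2\<close>, since \<open>w \<le> W / 8\<close>.\<close>
  have "W = w * N" using N by (simp add: w_def)
  then have "W - 2 * w \<le> D + Off + W / 4" using total by (simp add: N_def algebra_simps)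
  moreover have "w \<le> W / 8" unfolding w_def using N W by (intro divide_left_mono) auto
  ultimately have half: "W / 2 \<le> D + Off" using W by linarith
  have D_nn: "0 \<le> D" unfolding D_def by (intro sum_nonneg b(1))
  show ?thesis
  proof (cases "D \<le> W / 4")
    case True
    then show ?thesis using half W by (simp add: Off_def)
  next
    case False
    have diag: "?m p p \<le> w" if "p \<in> A" for p
      using b(2)[of p p] A(2)[OF that] by (simp add: w_def N_def)
    \<comment> \<open>The identity makes the off-diagonal mass equal to the geometric mean of the
      diagonal masses times \<open>exp (- b / \<epsilon>)\<close>. As both are at most
      \<open>w\<close>, their geometric mean is at least their product divided by \<open>w\<close>,
      and products can be summed.\<close>
    have lower: "?m p p * ?m q q / w * exp (- b / \<epsilon>) \<le> ?m p q" if "p \<in> A" "q \<in> A" "p \<noteq> q" for p q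
    proof (rule power2_le_imp_le)
      let ?s = "?m p p * ?m q q"
      have s: "0 \<le> ?s" by (intro mult_nonneg_nonneg b(1))
      have "?s \<le> w * w" by (intro mult_mono diag that b(1)) (use w in simp)
      then have "?s * ?s \<le> ?s * (w * w)" by (rule mult_left_mono[OF _ s])
      then have "(?s / w)\<^sup>2 \<le> ?s" using w by (simp add: power2_eq_square field_simps)
      then have "(?s / w)\<^sup>2 * (exp (- b / \<epsilon>))\<^sup>2 \<le> ?s * (exp (- b / \<epsilon>))\<^sup>2"
        by (intro mult_right_mono) auto
      also have "?s * (exp (- b / \<epsilon>))\<^sup>2 = (?m p q)\<^sup>2"
      proof -
        have "?s = (?m p q)\<^sup>2 * exp (2 * b / \<epsilon>)"
          using facts(3)[OF that(3)] cost_in[OF that] by simp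
        moreover have "exp (2 * b / \<epsilon>) * (exp (- b / \<epsilon>))\<^sup>2 = 1"
          by (simp add: exp_double[symmetric] exp_add[symmetric])
        ultimately show ?thesis by (simp only: mult.assoc mult_1_right)
      qed
      finally show "(?s / w * exp (- b / \<epsilon>))\<^sup>2 \<le> (?m p q)\<^sup>2" by (simp only: power_mult_distrib)
    qed (rule b(1))
    let ?I = "{(p, q). p \<in> A \<and> q \<in> A \<and> p \<noteq> q}"
    \<comment> \<open>Expand the square of \<open>D\<close>; the terms with \<open>p = q\<close>
      amount to at most \<open>D * w\<close>.\<close>
    have D2: "D\<^sup>2 - D * w \<le> (\<Sum>(p, q)\<in>?I. ?m p p * ?m q q)"
    proof -
      have "D\<^sup>2 = (\<Sum>(p, q)\<in>A \<times> A. ?m p p * ?m q q)"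
        by (simp add: D_def power2_eq_square sum_product sum.cartesian_product)
      also have "A \<times> A = ?I \<union> (\<lambda>p. (p, p)) ` A" by auto
      also have "(\<Sum>(p, q)\<in>\<dots>. ?m p p * ?m q q) =
          (\<Sum>(p, q)\<in>?I. ?m p p * ?m q q) + (\<Sum>(p, q)\<in>(\<lambda>p. (p, p)) ` A. ?m p p * ?m q q)"
        by (rule sum.union_disjoint) (use A(1) in \<open>auto intro: finite_subset[of _ "A \<times> A"]\<close>)
      also have "(\<Sum>(p, q)\<in>(\<lambda>p. (p, p)) ` A. ?m p p * ?m q q) = (\<Sum>p\<in>A. ?m p p * ?m p p)"
        by (simp add: sum.reindex inj_on_def)
      also have "\<dots> \<le> (\<Sum>p\<in>A. ?m p p * w)"
        by (intro sum_mono mult_left_mono diag b(1))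
      also have "\<dots> = D * w" by (simp add: D_def sum_distrib_right)
      finally show ?thesis by simp
    qed
    have "(D\<^sup>2 - D * w) / w * exp (- b / \<epsilon>) \<le> (\<Sum>(p, q)\<in>?I. ?m p p * ?m q q) / w * exp (- b / \<epsilon>)"
      using D2 w by (intro mult_right_mono divide_right_mono) auto
    also have "\<dots> = (\<Sum>(p, q)\<in>?I. ?m p p * ?m q q / w * exp (- b / \<epsilon>))"
      by (simp add: sum_divide_distrib sum_distrib_right case_prod_beta)
    also have "\<dots> \<le> Off"
      unfolding Off by (rule sum_mono) (use lower in auto)
    finally have Off_lower: "(D\<^sup>2 - D * w) / w * exp (- b / \<epsilon>) \<le> Off" .
    have e: "1 / N \<le> exp (- b / \<epsilon>)"
      using large(2) N by (simp add: N_def exp_minus field_simps)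
    have "N / 4 \<le> D / w"
    proof -
      have "W / 4 / w \<le> D / w" using False w by (intro divide_right_mono) auto
      also have "W / 4 / w = N / 4" using W N by (simp add: w_def)
      finally show ?thesis .
    qed
    \<comment> \<open>\<open>N / 4 - 1 \<ge> N / 8\<close> because \<open>8 \<le> N\<close>; this
      and \<open>w \<le> W / 8\<close> are where \<open>7 \<le> card A\<close> enters.\<close>
    then have DN: "N / 8 \<le> D / w - 1" using N by linarith
    have "W / 4 * (N / 8) \<le> D * (D / w - 1)"
      using False DN N W D_nn by (intro mult_mono) auto
    also have "\<dots> = (D\<^sup>2 - D * w) / w" using w by (simp add: power2_eq_square field_simps)
    finally have q: "W / 4 * (N / 8) \<le> (D\<^sup>2 - D * w) / w" .
    \<comment> \<open>The factor \<open>N\<close> gained from the number of cells cancels against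
      \<open>exp (- b / \<epsilon>) \<ge> 1 / N\<close>.\<close>
    have "W / 32 = W / 4 * (N / 8) * (1 / N)" using N by simp
    also have "\<dots> \<le> (D\<^sup>2 - D * w) / w * exp (- b / \<epsilon>)"
      using q e N W by (intro mult_mono) (auto intro: order_trans[rotated, OF q])
    also note Off_lower
    finally show ?thesis by (simp only: Off_def)
  qed
qed

end

section \<open>The block model\<close>

lemma in_cell_spaceE:
  assumes "x \<in> cell_space \<kappa>"
  obtains n i where "(n, i) \<in> labels \<kappa>" "x \<in> cell \<kappa> n i" "label \<kappa> x = (n, i)"
  using assms label_eq by (fastforce simp: cell_space_eq)

lemma label_in_labels: "x \<in> cell_space \<kappa> \<Longrightarrow> label \<kappa> x \<in> labels \<kappa>"
  by (erule in_cell_spaceE) simp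

text \<open>Unit cells with points at distance below 1 have integer left ends less than 2 apart,
  hence at most 1 apart. The larger left end then lies in both closed cells, and
  \<open>cell_unique\<close> applies.\<close>

lemma label_locally_constant:
  assumes "x \<in> cell_space \<kappa>" "y \<in> cell_space \<kappa>" "dist x y < 1"
  shows "label \<kappa> x = label \<kappa> y"
proof -
  obtain n i where x: "(n, i) \<in> labels \<kappa>" "x \<in> cell \<kappa> n i" "label \<kappa> x = (n, i)"
    by (rule in_cell_spaceE[OF assms(1)])
  obtain m j where y: "(m, j) \<in> labels \<kappa>" "y \<in> cell \<kappa> m j" "label \<kappa> y = (m, j)"
    by (rule in_cell_spaceE[OF assms(2)])
  let ?s = "block_start \<kappa> n + 3 * i" and ?t = "block_start \<kappa> m + 3 * j"
  have "real ?s < real (?t + 2)" "real ?t < real (?s + 2)"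
    using x(2) y(2) assms(3) by (auto simp: cell_def dist_real_def)
  then have "?s < ?t + 2" "?t < ?s + 2"
    by (simp_all only: of_nat_less_iff)
  then have le: "?s \<le> ?t + 1" "?t \<le> ?s + 1" by simp_all
  have "real (max ?s ?t) \<in> cell \<kappa> n i" "real (max ?s ?t) \<in> cell \<kappa> m j"
    using le by (auto simp: cell_def max_def of_nat_le_iff[symmetric, where ?'a = real] simp del: of_nat_le_iff)
  from cell_unique[OF x(1) y(1) this] show ?thesis by (simp add: x(3) y(3))
qed

text \<open>Radius 1 serves every point, for any condition on the two labels. As the complement is
  given by a condition of the same kind, such sets are clopen, so both large-deviation bounds apply
  to them.\<close>

lemma openin_label_pairs:
  "openin (top_of_set (cell_space \<kappa> \<times> cell_space \<kappa>))
     {z \<in> cell_space \<kappa> \<times> cell_space \<kappa>. Q (label \<kappa> (fst z)) (label \<kappa> (snd z))}"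
  unfolding openin_contains_ball
proof (intro conjI ballI exI[of _ 1])
  let ?S = "cell_space \<kappa> \<times> cell_space \<kappa>"
  fix z assume z: "z \<in> {z \<in> ?S. Q (label \<kappa> (fst z)) (label \<kappa> (snd z))}"
  show "ball z 1 \<inter> ?S \<subseteq> {z \<in> ?S. Q (label \<kappa> (fst z)) (label \<kappa> (snd z))}"
  proof
    fix u assume u: "u \<in> ball z 1 \<inter> ?S"
    have "dist (fst z) (fst u) < 1" "dist (snd z) (snd u) < 1"
      using u dist_fst_le[of z u] dist_snd_le[of z u] by auto
    with z u have "label \<kappa> (fst z) = label \<kappa> (fst u)" "label \<kappa> (snd z) = label \<kappa> (snd u)"
      by (auto intro!: label_locally_constant)
    with z u show "u \<in> {z \<in> ?S. Q (label \<kappa> (fst z)) (label \<kappa> (snd z))}" by auto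
  qed
qed auto

lemma closedin_label_pairs:
  "closedin (top_of_set (cell_space \<kappa> \<times> cell_space \<kappa>))
     {z \<in> cell_space \<kappa> \<times> cell_space \<kappa>. Q (label \<kappa> (fst z)) (label \<kappa> (snd z))}"
proof -
  let ?S = "cell_space \<kappa> \<times> cell_space \<kappa>"
  have "{z \<in> ?S. Q (label \<kappa> (fst z)) (label \<kappa> (snd z))} =
      ?S - {z \<in> ?S. \<not> Q (label \<kappa> (fst z)) (label \<kappa> (snd z))}" by auto
  then show ?thesis
    using openin_label_pairs[of \<kappa> "\<lambda>p q. \<not> Q p q"] by (simp add: closedin_def Diff_Diff_Int Int_absorb1 subset_iff)
qed

section \<open>Masses of labels and blocks\<close>

lemma weight_nonneg: "0 \<le> weight n"
  using zeta3(2) by (simp add: weight_def)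

lemma sets_labels: "{x \<in> cell_space \<kappa>. label \<kappa> x \<in> K} \<in> sets (cell_measure \<kappa>)"
proof -
  have eq: "{x \<in> cell_space \<kappa>. label \<kappa> x \<in> K} = (\<Union>p\<in>labels \<kappa> \<inter> K. cell \<kappa> (fst p) (snd p))"
  proof (rule set_eqI)
    fix x
    show "x \<in> {x \<in> cell_space \<kappa>. label \<kappa> x \<in> K} \<longleftrightarrow> x \<in> (\<Union>p\<in>labels \<kappa> \<inter> K. cell \<kappa> (fst p) (snd p))"
      by (force simp: cell_space_eq label_eq)
  qed
  have "{x \<in> cell_space \<kappa>. label \<kappa> x \<in> K} \<in> sets borel"
    unfolding eq by (intro sets.countable_UN') (auto simp: cell_def)
  then have "cell_space \<kappa> \<inter> {x \<in> cell_space \<kappa>. label \<kappa> x \<in> K} \<in> sets (restrict_space borel (cell_space \<kappa>))"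
    by (auto simp: sets_restrict_space)
  moreover have "cell_space \<kappa> \<inter> {x \<in> cell_space \<kappa>. label \<kappa> x \<in> K} = {x \<in> cell_space \<kappa>. label \<kappa> x \<in> K}"
    by auto
  ultimately show ?thesis by (simp add: sets_cell_measure)
qed

lemma emeasure_labels:
  "emeasure (cell_measure \<kappa>) {x \<in> cell_space \<kappa>. label \<kappa> x \<in> K} =
    (\<Sum>n. \<Sum>i\<le>label_count \<kappa> (Suc n).
      if (Suc n, i) \<in> K then ennreal (weight (Suc n) / (real (label_count \<kappa> (Suc n)) + 1)) else 0)"
proof -
  let ?A = "{x \<in> cell_space \<kappa>. label \<kappa> x \<in> K}"
  have "emeasure lborel (?A \<inter> cell \<kappa> (Suc n) i) = (if (Suc n, i) \<in> K then 1 else 0)"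
    if "i \<le> label_count \<kappa> (Suc n)" for n i
  proof -
    have l: "(Suc n, i) \<in> labels \<kappa>" using that by (simp add: labels_def)
    have "?A \<inter> cell \<kappa> (Suc n) i = (if (Suc n, i) \<in> K then cell \<kappa> (Suc n) i else {})"
      using l label_eq[OF l] by (auto simp: cell_space_eq)
    then show ?thesis by (simp add: cell_def)
  qed
  then show ?thesis
    unfolding emeasure_cell_measure[OF sets_labels] cell_measure_fun_def
    by (intro suminf_cong sum.cong) auto
qed

lemma emeasure_label_cell:
  assumes "(n, i) \<in> labels \<kappa>"
  shows "emeasure (cell_measure \<kappa>) {x \<in> cell_space \<kappa>. label \<kappa> x = (n, i)} =
    ennreal (weight n / (real (label_count \<kappa> n) + 1))"
proof -
  obtain n' where n: "n = Suc n'" and i: "i \<le> label_count \<kappa> n"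
    using assms by (cases n) (auto simp: labels_def)
  let ?w = "\<lambda>n. ennreal (weight (Suc n) / (real (label_count \<kappa> (Suc n)) + 1))"
  have "emeasure (cell_measure \<kappa>) {x \<in> cell_space \<kappa>. label \<kappa> x \<in> {(n, i)}} =
      (\<Sum>k. if k = n' then ?w n' else 0)"
    unfolding emeasure_labels
  proof (rule suminf_cong)
    fix k
    show "(\<Sum>j\<le>label_count \<kappa> (Suc k). if (Suc k, j) \<in> {(n, i)} then ?w k else 0) = (if k = n' then ?w n' else 0)"
      using i by (cases "k = n'") (simp_all add: n sum.delta)
  qed
  also have "\<dots> = ?w n'"
    using suminf_finite[of "{n'}" "\<lambda>k. if k = n' then ?w n' else 0"] by simp
  finally show ?thesis by (simp add: n)
qed

lemma emeasure_label_block: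
  "emeasure (cell_measure \<kappa>) {x \<in> cell_space \<kappa>. fst (label \<kappa> x) = n} = ennreal (weight n)"
proof -
  have inner: "(\<Sum>j\<le>label_count \<kappa> (Suc k).
      if (Suc k, j) \<in> {p. fst p = n} then ennreal (weight (Suc k) / (real (label_count \<kappa> (Suc k)) + 1)) else 0)
      = (if Suc k = n then ennreal (weight n) else 0)" for k
    using weight_nonneg[of n]
    by (auto simp: ennreal_of_nat_eq_real_of_nat ennreal_mult[symmetric] simp del: of_nat_Suc)
      (simp add: field_simps)
  have "emeasure (cell_measure \<kappa>) {x \<in> cell_space \<kappa>. label \<kappa> x \<in> {p. fst p = n}} =
      (\<Sum>k. if Suc k = n then ennreal (weight n) else 0)"
    unfolding emeasure_labels inner ..
  also have "\<dots> = ennreal (weight n)"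
  proof (cases n)
    case 0
    \<comment> \<open>Division by 0 yields 0, so \<open>weight 0\<close> is 0, in agreement with
      block 0 being empty.\<close>
    then show ?thesis by (simp add: weight_def)
  next
    case (Suc n')
    then show ?thesis
      using suminf_finite[of "{n'}" "\<lambda>k. if Suc k = n then ennreal (weight n) else 0"] by simp
  qed
  finally show ?thesis by simp
qed

lemma label_measurable_cell: "label \<kappa> \<in> cell_measure \<kappa> \<rightarrow>\<^sub>M count_space UNIV"
  unfolding measurable_count_space_eq2_countable
proof (intro conjI ballI)
  fix p :: "nat \<times> nat"
  have "label \<kappa> -` {p} \<inter> space (cell_measure \<kappa>) = {x \<in> cell_space \<kappa>. label \<kappa> x \<in> {p}}"
    by (auto simp: space_cell_measure)
  then show "label \<kappa> -` {p} \<inter> space (cell_measure \<kappa>) \<in> sets (cell_measure \<kappa>)"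
    by (simp only: sets_labels)
qed auto

text \<open>The mean block index is a constant times the sum of \<open>1 / n ^ 2\<close>. Logarithms
  of label masses grow linearly in the block index, so this gives the finite label entropy.\<close>

lemma integrable_block_index: "integrable (cell_measure \<kappa>) (\<lambda>x. real (fst (label \<kappa> x)))"
proof -
  let ?M = "cell_measure \<kappa>"
  let ?B = "\<lambda>x. fst (label \<kappa> x)"
  have B [measurable]: "?B \<in> ?M \<rightarrow>\<^sub>M count_space UNIV"
    by (rule measurable_compose[OF label_measurable_cell]) simp
  have "(\<integral>\<^sup>+x. ennreal (real (?B x)) \<partial>?M) = (\<integral>\<^sup>+n. ennreal (real n) \<partial>distr ?M (count_space UNIV) ?B)"
    by (subst nn_integral_distr) auto
  also have "\<dots> = (\<integral>\<^sup>+n. emeasure (distr ?M (count_space UNIV) ?B) {n} * ennreal (real n) \<partial>count_space UNIV)"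
    by (rule nn_integral_countable_type) simp
  also have "\<dots> = (\<integral>\<^sup>+n. ennreal (weight n * real n) \<partial>count_space UNIV)"
  proof (rule nn_integral_cong)
    fix n
    have "emeasure (distr ?M (count_space UNIV) ?B) {n} = emeasure ?M {x \<in> cell_space \<kappa>. ?B x = n}"
      by (subst emeasure_distr[OF B]) (auto simp: space_cell_measure intro!: arg_cong[where f = "emeasure ?M"])
    then show "emeasure (distr ?M (count_space UNIV) ?B) {n} * ennreal (real n) = ennreal (weight n * real n)"
      by (simp add: emeasure_label_block ennreal_mult weight_nonneg)
  qed
  also have "\<dots> = (\<Sum>n. ennreal (weight n * real n))"
    by (rule nn_integral_count_space_nat)
  also have "\<dots> < \<infinity>"
  proof -
    have "weight n * real n = (1 / zeta3) * inverse (real n ^ 2)" for n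
      by (cases "n = 0") (simp_all add: weight_def power3_eq_cube power2_eq_square field_simps)
    then have "summable (\<lambda>n. weight n * real n)"
      by (simp only:) (intro summable_mult inverse_power_summable, simp)
    then show ?thesis
      using weight_nonneg by (simp add: suminf_ennreal2)
  qed
  finally show ?thesis
    by (intro integrableI_nonneg) (auto simp: top.not_eq_extremum infinity_ennreal_def)
qed

text \<open>The analytic point is the label entropy: a label of block \<open>n\<close> has mass of
  order \<open>exp (- \<kappa> * n) / n ^ 3\<close>, whose logarithm is dominated by a multiple of
  \<open>n\<close>.\<close>

lemma labelled_space_cell_measure:
  assumes "0 \<le> a" "0 \<le> b" "0 \<le> \<kappa>"
  shows "labelled_space (cell_measure \<kappa>) (cell_space \<kappa>) (label \<kappa>) (label_cost a b)"
proof -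
  interpret prob_space "cell_measure \<kappa>" by (rule prob_space_cell_measure)
  have mass: "prob {y \<in> space (cell_measure \<kappa>). label \<kappa> y = label \<kappa> x} =
      weight (fst (label \<kappa> x)) / (real (label_count \<kappa> (fst (label \<kappa> x))) + 1)"
    and lab: "1 \<le> fst (label \<kappa> x)"
    if "x \<in> space (cell_measure \<kappa>)" for x
  proof -
    have "label \<kappa> x \<in> labels \<kappa>"
      using that by (intro label_in_labels) (simp add: space_cell_measure)
    then obtain n i where l: "(n, i) \<in> labels \<kappa>" "label \<kappa> x = (n, i)"
      by (cases "label \<kappa> x") auto
    show "1 \<le> fst (label \<kappa> x)" using l by (simp add: labels_def)
    show "prob {y \<in> space (cell_measure \<kappa>). label \<kappa> y = label \<kappa> x} =
      weight (fst (label \<kappa> x)) / (real (label_count \<kappa> (fst (label \<kappa> x))) + 1)"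
      using emeasure_label_cell[OF l(1)] weight_nonneg[of n]
      by (simp add: l(2) measure_def space_cell_measure)
  qed
  \<comment> \<open>\<open>ln 3 + \<kappa>\<close> comes from
    \<open>label_count \<kappa> n + 1 \<le> 3 * exp (\<kappa> * n)\<close>, and
    \<open>\<bar>ln zeta3\<bar> + 3\<close> from the weight together with
    \<open>ln n \<le> n\<close>. Constants are absorbed into multiples of \<open>n\<close> since
    \<open>1 \<le> n\<close>.\<close>
  define A where "A = \<bar>ln zeta3\<bar> + 3 + ln 3 + \<kappa>"
  have bound: "\<bar>ln (weight n / (real (label_count \<kappa> n) + 1))\<bar> \<le> A * real n" if n: "1 \<le> n"
    and le1: "weight n / (real (label_count \<kappa> n) + 1) \<le> 1" for n
  proof -
    let ?m = "real (label_count \<kappa> n)"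
    have w: "0 < weight n" using n zeta3(2) by (simp add: weight_def)
    have ge1: "1 \<le> exp (\<kappa> * real n)" using assms(3) by simp
    have "?m \<le> 2 * exp (\<kappa> * real n)"
    proof -
      have "real (nat \<lfloor>exp (\<kappa> * real n)\<rfloor>) \<le> exp (\<kappa> * real n)"
        using ge1 by linarith
      moreover have "?m = max 2 (real (nat \<lfloor>exp (\<kappa> * real n)\<rfloor>))"
        by (simp add: label_count_def of_nat_max)
      ultimately show ?thesis using ge1 by linarith
    qed
    then have "ln (?m + 1) \<le> ln (3 * exp (\<kappa> * real n))"
      using ge1 by (intro ln_mono) linarith+
    also have "\<dots> = ln 3 + \<kappa> * real n" by (simp add: ln_mult)
    finally have m: "ln (?m + 1) \<le> ln 3 + \<kappa> * real n" .
    have "ln (weight n) = - ln zeta3 - 3 * ln (real n)"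
      using zeta3(2) n by (simp add: weight_def ln_mult ln_div ln_realpow)
    moreover have "ln (real n) \<le> real n" using n ln_le_minus_one[of "real n"] by simp
    moreover have "ln (weight n / (?m + 1)) = ln (weight n) - ln (?m + 1)"
      using w by (simp add: ln_div)
    ultimately have "- ln (weight n / (?m + 1)) \<le> \<bar>ln zeta3\<bar> + ln 3 + (3 + \<kappa>) * real n"
      using m by (simp add: algebra_simps)
    also have "\<dots> \<le> (\<bar>ln zeta3\<bar> + ln 3) * real n + (3 + \<kappa>) * real n"
      using n mult_left_mono[of 1 "real n" "\<bar>ln zeta3\<bar> + ln 3"] by simp
    also have "\<dots> = A * real n" by (simp add: A_def algebra_simps)
    finally have "- ln (weight n / (?m + 1)) \<le> A * real n" .
    moreover have "ln (weight n / (?m + 1)) \<le> 0"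
      using le1 w by (subst ln_le_zero_iff) auto
    ultimately show ?thesis by simp
  qed
  show ?thesis
  proof
    show "sets (cell_measure \<kappa>) = sets (restrict_space borel (cell_space \<kappa>))"
      by (rule sets_cell_measure)
    show lm: "label \<kappa> \<in> cell_measure \<kappa> \<rightarrow>\<^sub>M count_space UNIV" by (rule label_measurable_cell)
    show "0 < prob {y \<in> space (cell_measure \<kappa>). label \<kappa> y = label \<kappa> x}"
      if "x \<in> space (cell_measure \<kappa>)" for x
      using lab[OF that] zeta3(2) by (simp add: mass[OF that] weight_def)
    show "integrable (cell_measure \<kappa>) (\<lambda>x. ln (prob {y \<in> space (cell_measure \<kappa>). label \<kappa> y = label \<kappa> x}))"
    proof (rule Bochner_Integration.integrable_bound)
      show "integrable (cell_measure \<kappa>) (\<lambda>x. A * real (fst (label \<kappa> x)))"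
        by (intro integrable_mult_right integrable_block_index)
      show "(\<lambda>x. ln (prob {y \<in> space (cell_measure \<kappa>). label \<kappa> y = label \<kappa> x})) \<in> borel_measurable (cell_measure \<kappa>)"
        by (rule measurable_compose[OF lm]) simp
      show "AE x in cell_measure \<kappa>. norm (ln (prob {y \<in> space (cell_measure \<kappa>). label \<kappa> y = label \<kappa> x}))
          \<le> norm (A * real (fst (label \<kappa> x)))"
      proof (rule AE_I2)
        fix x assume x: "x \<in> space (cell_measure \<kappa>)"
        have "prob {y \<in> space (cell_measure \<kappa>). label \<kappa> y = label \<kappa> x} \<le> 1" by simp
        then show "norm (ln (prob {y \<in> space (cell_measure \<kappa>). label \<kappa> y = label \<kappa> x}))
          \<le> norm (A * real (fst (label \<kappa> x)))"
          using bound[OF lab[OF x]] unfolding mass[OF x] by simp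
      qed
    qed
    show "0 \<le> label_cost a b p q" for p q
      using assms by (cases p; cases q) (simp add: cross_cost_def)
    show "label_cost a b p q = label_cost a b q p" for p q
      by (cases p; cases q) auto
    show "label_cost a b p p = 0" for p
      by (cases p) simp
  qed
qed

section \<open>Limits as \<epsilon> tends to 0 and the contradiction\<close>

lemma Liminf_at_right_le_const:
  fixes f :: "real \<Rightarrow> ereal"
  assumes "\<forall>\<^sub>F x in at_right 0. f x \<le> c"
  shows "Liminf (at_right 0) f \<le> c"
  using Liminf_mono[OF assms] by (simp add: Liminf_const)

lemma Limsup_at_right_ge_const:
  fixes f :: "real \<Rightarrow> ereal"
  assumes "\<forall>\<^sub>F x in at_right 0. c \<le> f x"
  shows "c \<le> Limsup (at_right 0) f"
  using Limsup_mono[OF assms] by (simp add: Limsup_const)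

text \<open>A mass of polynomial order in \<epsilon> has exponential rate 0 at speed
  \<open>1 / \<epsilon>\<close>.\<close>

lemma tendsto_eps_ln_cubic:
  fixes K d :: real
  assumes "0 < K" "0 < d"
  shows "((\<lambda>\<epsilon>. \<epsilon> * ln (1 / (K * (d / \<epsilon> + 1) ^ 3))) \<longlongrightarrow> 0) (at_right 0)"
  using assms by real_asymp

lemma eventually_eps_large:
  fixes R d :: real
  assumes "0 < d"
  shows "\<forall>\<^sub>F \<epsilon> in at_right 0. R \<le> d / \<epsilon>"
proof -
  have "filterlim (\<lambda>\<epsilon>. d / \<epsilon>) at_top (at_right 0)" using assms by real_asymp
  then show ?thesis by (simp add: filterlim_at_top)
qed

theorem theorem1p2:
  fixes a b \<kappa> :: real and P :: "real \<Rightarrow> (real \<times> real) measure"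
  assumes "0 < 2 * a" "2 * a < \<kappa>" "\<kappa> < b"
    and "\<And>\<epsilon>. 0 < \<epsilon> \<Longrightarrow>
      is_entropic_minimiser (cell_space \<kappa>) (cost a b \<kappa>) (cell_measure \<kappa>) \<epsilon> (P \<epsilon>)"
  shows "\<not> (\<exists>I :: real \<times> real \<Rightarrow> ennreal. full_LDP (cell_space \<kappa> \<times> cell_space \<kappa>) P I)"
proof
  assume "\<exists>I :: real \<times> real \<Rightarrow> ennreal. full_LDP (cell_space \<kappa> \<times> cell_space \<kappa>) P I"
  then obtain I :: "real \<times> real \<Rightarrow> ennreal" where LDP: "full_LDP (cell_space \<kappa> \<times> cell_space \<kappa>) P I" ..
  have pos: "0 < a" "0 < \<kappa>" "0 < b" using assms(1-3) by auto
  interpret L: labelled_space "cell_measure \<kappa>" "cell_space \<kappa>" "label \<kappa>" "label_cost a b"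
    using pos by (intro labelled_space_cell_measure) auto
  let ?S = "cell_space \<kappa> \<times> cell_space \<kappa>"
  have space: "space (cell_measure \<kappa> \<Otimes>\<^sub>M cell_measure \<kappa>) = ?S"
    by (simp add: space_pair_measure space_cell_measure)
  have min: "is_entropic_minimiser (cell_space \<kappa>) (\<lambda>x y. label_cost a b (label \<kappa> x) (label \<kappa> y)) (cell_measure \<kappa>) \<epsilon> (P \<epsilon>)"
    if "0 < \<epsilon>" for \<epsilon>
    using assms(4)[OF that] by (simp add: cost_def[abs_def])
  \<comment> \<open>Index 0 is excluded because a pair of one zero and one nonzero index costs only
    \<open>a\<close>.\<close>
  define offdiag where "offdiag = (\<lambda>p q :: nat \<times> nat. fst p = fst q \<and> 1 \<le> snd p \<and> 1 \<le> snd q \<and> p \<noteq> q)"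
  have cost_b: "label_cost a b p q = b" if "offdiag p q" for p q
    using that by (cases p; cases q) (auto simp: offdiag_def)
  define C where "C = {z \<in> ?S. offdiag (label \<kappa> (fst z)) (label \<kappa> (snd z))}"
  have upper: "Limsup (at_right 0) (\<lambda>\<epsilon>. ereal \<epsilon> * elog (measure (P \<epsilon>) C)) \<le> - enn2ereal (INF z\<in>C. I z)"
    using LDP closedin_label_pairs[of \<kappa> offdiag] by (simp add: full_LDP_def C_def)
  \<comment> \<open>The lower bound is applied to the single label cell containing \<open>z\<close>,
    which is open. Its mass is at most \<open>exp (- b / \<epsilon>)\<close>, so the infimum of
    \<open>I\<close> over it, and with it \<open>I z\<close>, is at least \<open>b\<close>.\<close>
  have rate: "ennreal b \<le> I z" if z: "z \<in> C" for z
  proof -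
    define p where "p = label \<kappa> (fst z)"
    define q where "q = label \<kappa> (snd z)"
    have pq: "offdiag p q" "p \<noteq> q" using z by (auto simp: C_def p_def q_def offdiag_def)
    let ?U = "{z \<in> ?S. label \<kappa> (fst z) = p \<and> label \<kappa> (snd z) = q}"
    have "- enn2ereal (INF z\<in>?U. I z) \<le> Liminf (at_right 0) (\<lambda>\<epsilon>. ereal \<epsilon> * elog (measure (P \<epsilon>) ?U))"
      using LDP openin_label_pairs[of \<kappa> "\<lambda>p' q'. p' = p \<and> q' = q"] by (simp add: full_LDP_def)
    also have "\<dots> \<le> ereal (- b)"
    proof (rule Liminf_at_right_le_const, rule eventually_at_right_less[THEN eventually_mono])
      fix \<epsilon> :: real assume \<epsilon>: "0 < \<epsilon>"
      have le: "measure (P \<epsilon>) ?U \<le> exp (- b / \<epsilon>)"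
        using L.off_diagonal_small[OF min[OF \<epsilon>] \<epsilon> pq(2)] cost_b[OF pq(1)]
        by (simp add: L.cell_mass_def space)
      show "ereal \<epsilon> * elog (measure (P \<epsilon>) ?U) \<le> ereal (- b)"
      proof (cases "measure (P \<epsilon>) ?U = 0")
        case True
        then show ?thesis using \<epsilon> by (simp add: elog_def)
      next
        case False
        then have "0 < measure (P \<epsilon>) ?U" using measure_nonneg[of "P \<epsilon>" ?U] by linarith
        then have "ln (measure (P \<epsilon>) ?U) \<le> - b / \<epsilon>"
          using ln_mono[OF le] by simp
        then have "\<epsilon> * ln (measure (P \<epsilon>) ?U) \<le> - b"
          using \<epsilon> by (simp only: pos_le_divide_eq mult.commute)
        then show ?thesis using False by (simp add: elog_def)
      qed
    qed
    finally have "ereal b \<le> enn2ereal (INF z\<in>?U. I z)"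
      using ereal_minus_le_minus[of "enn2ereal (INF z\<in>?U. I z)" "ereal b"] by simp
    then have "ennreal b \<le> (INF z\<in>?U. I z)"
      using pos(3) by (simp add: less_eq_ennreal.rep_eq)
    also have "\<dots> \<le> I z"
      using z by (intro INF_lower) (auto simp: C_def p_def q_def)
    finally show ?thesis .
  qed
  have "ennreal b \<le> (INF z\<in>C. I z)" by (intro INF_greatest rate)
  then have "ereal b \<le> enn2ereal (INF z\<in>C. I z)"
    using pos(3) by (simp add: less_eq_ennreal.rep_eq)
  then have "- enn2ereal (INF z\<in>C. I z) \<le> ereal (- b)"
    using ereal_minus_le_minus[of "enn2ereal (INF z\<in>C. I z)" "ereal b"] by simp
  with upper have "Limsup (at_right 0) (\<lambda>\<epsilon>. ereal \<epsilon> * elog (measure (P \<epsilon>) C)) \<le> ereal (- b)"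
    by (rule order_trans)
  \<comment> \<open>Any constant strictly between \<open>- b\<close> and 0 would contradict the
    upper bound.\<close>
  moreover have "ereal (- b / 2) \<le> Limsup (at_right 0) (\<lambda>\<epsilon>. ereal \<epsilon> * elog (measure (P \<epsilon>) C))"
  proof (rule Limsup_at_right_ge_const)
    \<comment> \<open>From block index \<open>d / \<epsilon>\<close> on,
      \<open>exp (\<kappa> * n)\<close> is at least \<open>exp (b / \<epsilon>)\<close>.\<close>
    define d where "d = b / \<kappa>"
    have d: "0 < d" using pos by (simp add: d_def)
    have z3: "0 < zeta3" by (rule zeta3(2))
    have ev1: "\<forall>\<^sub>F \<epsilon> in at_right 0. - b / 2 < \<epsilon> * ln (1 / (32 * zeta3 * (d / \<epsilon> + 1) ^ 3))"
      using tendsto_eps_ln_cubic[of "32 * zeta3" d] d z3 pos(3) by (intro order_tendstoD(1)) auto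
    \<comment> \<open>The mass leaving block \<open>n\<close> is at most \<epsilon> times the label
      entropy over \<open>n ^ 4\<close>, to be compared with a quarter of a weight of order
      \<open>n ^ (- 3)\<close>. The spare power of \<open>n\<close> absorbs the entropy once
      \<open>n\<close> is this large.\<close>
    have ev2: "\<forall>\<^sub>F \<epsilon> in at_right 0. 4 * zeta3 * \<bar>L.label_entropy\<bar> \<le> d / \<epsilon>"
      by (rule eventually_eps_large[OF d])
    \<comment> \<open>This makes \<open>exp (b / \<epsilon>)\<close> at least 8, hence gives at
      least 7 nonzero indices.\<close>
    have ev3: "\<forall>\<^sub>F \<epsilon> in at_right 0. ln 8 \<le> b / \<epsilon>"
      by (rule eventually_eps_large[OF pos(3)])
    have ev4: "\<forall>\<^sub>F \<epsilon> in at_right 0. 0 < \<epsilon> \<and> \<epsilon> < (1::real)"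
      unfolding eventually_at_right_field by (intro exI[of _ 1]) auto
    show "\<forall>\<^sub>F \<epsilon> in at_right 0. ereal (- b / 2) \<le> ereal \<epsilon> * elog (measure (P \<epsilon>) C)"
      using ev1 ev2 ev3 ev4
    proof eventually_elim
      case (elim \<epsilon>)
      then have \<epsilon>: "0 < \<epsilon>" "\<epsilon> < 1" by auto
      define n where "n = nat \<lceil>d / \<epsilon>\<rceil>"
      have dpos: "0 < d / \<epsilon>" using d \<epsilon> by simp
      have n_ge: "d / \<epsilon> \<le> real n" unfolding n_def by linarith
      have n_le: "real n \<le> d / \<epsilon> + 1" unfolding n_def using dpos by linarith
      have n1: "1 \<le> n" using n_ge dpos by (cases n) auto
      define m where "m = label_count \<kappa> n"
      let ?A = "Pair n ` {1..m}"
      have card: "card ?A = m" by (simp add: card_image inj_on_def)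
      have mass: "L.mass (n, i) = weight n / (real m + 1)" if "i \<le> m" for i
        using emeasure_label_cell[of n i \<kappa>] that n1 weight_nonneg[of n]
        by (simp add: L.mass_def measure_def space_cell_measure labels_def m_def)
      have "b / \<epsilon> = \<kappa> * (d / \<epsilon>)" using pos by (simp add: d_def)
      also have "\<dots> \<le> \<kappa> * real n" using n_ge pos by (intro mult_left_mono) auto
      finally have "exp (b / \<epsilon>) \<le> exp (\<kappa> * real n)" by simp
      also have "\<dots> \<le> real m + 1"
      proof -
        \<comment> \<open>The floor loses less than 1, which the index 0 of the block makes up
          for.\<close>
        have "exp (\<kappa> * real n) \<le> real (nat \<lfloor>exp (\<kappa> * real n)\<rfloor>) + 1" by linarith
        also have "\<dots> \<le> real m + 1" by (simp add: m_def label_count_def)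
        finally show ?thesis .
      qed
      finally have exp_m: "exp (b / \<epsilon>) \<le> real m + 1" .
      have "8 \<le> exp (b / \<epsilon>)" using elim(3) by (metis exp_le_cancel_iff exp_ln zero_less_numeral)
      then have m7: "7 \<le> m" using exp_m by linarith
      have W: "0 < weight n" using n1 z3 by (simp add: weight_def)
      have ent: "\<epsilon> * L.label_entropy / cross_cost n \<le> weight n / 4"
      proof -
        have "\<epsilon> * L.label_entropy \<le> \<epsilon> * \<bar>L.label_entropy\<bar>"
          using \<epsilon> by (intro mult_left_mono) auto
        also have "\<dots> \<le> \<bar>L.label_entropy\<bar>"
          using \<epsilon> by (intro mult_left_le_one_le) auto
        finally have "4 * zeta3 * (\<epsilon> * L.label_entropy) \<le> 4 * zeta3 * \<bar>L.label_entropy\<bar>"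
          using z3 by (intro mult_left_mono) auto
        also have "\<dots> \<le> real n" using elim(2) n_ge by linarith
        finally have "\<epsilon> * L.label_entropy \<le> real n / (4 * zeta3)"
          using z3 by (simp add: pos_le_divide_eq mult.commute)
        then have "\<epsilon> * L.label_entropy / cross_cost n \<le> real n / (4 * zeta3) / cross_cost n"
          by (intro divide_right_mono) (auto simp: cross_cost_def)
        also have "\<dots> = weight n / 4"
          using n1 z3 by (simp add: weight_def cross_cost_def power_def eval_nat_numeral)
        finally show ?thesis .
      qed
      have "weight n / 32 \<le> measure (P \<epsilon>) {z \<in> ?S. label \<kappa> (fst z) \<in> ?A \<and> label \<kappa> (snd z) \<in> ?A \<and> label \<kappa> (fst z) \<noteq> label \<kappa> (snd z)}"
        unfolding space[symmetric]
      proof (rule L.block_off_diagonal_mass[OF min[OF \<epsilon>(1)] \<epsilon>(1), where h = "(n, 0)" and b = b and L = "cross_cost n"])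
        show "label_cost a b p q = b" if "p \<in> ?A" "q \<in> ?A" "p \<noteq> q" for p q
          using that by (intro cost_b) (auto simp: offdiag_def)
        show "cross_cost n \<le> label_cost a b p (label \<kappa> x)"
          if p: "p \<in> ?A" and x: "x \<in> space (cell_measure \<kappa>)" "label \<kappa> x \<notin> insert (n, 0) ?A" for p x
        proof -
          have lab: "label \<kappa> x \<in> labels \<kappa>" using x(1) by (intro label_in_labels) (simp add: space_cell_measure)
          obtain k j where kj: "label \<kappa> x = (k, j)" by (cases "label \<kappa> x")
          have "k \<noteq> n"
          proof
            assume "k = n"
            with lab kj x(2) show False by (cases "j = 0") (auto simp: labels_def m_def)
          qed
          then show ?thesis using p by (auto simp: kj cross_cost_def)
        qed
        show "0 < cross_cost n" using n1 by (simp add: cross_cost_def)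
      qed (use mass card ent W m7 exp_m in auto)
      also have "\<dots> \<le> measure (P \<epsilon>) C"
      proof -
        note PD = L.couplingD[OF L.minimiser_facts(1)[OF min[OF \<epsilon>(1)] \<epsilon>(1)]]
        interpret P: prob_space "P \<epsilon>" by (rule PD(1))
        have "(\<lambda>z. offdiag (label \<kappa> (fst z)) (label \<kappa> (snd z))) \<in> cell_measure \<kappa> \<Otimes>\<^sub>M cell_measure \<kappa> \<rightarrow>\<^sub>M count_space UNIV"
          by (rule L.lift_measurable) simp
        then have "C \<in> sets (P \<epsilon>)" unfolding PD(2) C_def space[symmetric] by (simp add: pred_def)
        then show ?thesis
          by (intro P.finite_measure_mono) (auto simp: C_def offdiag_def)
      qed
      finally have W_le: "weight n / 32 \<le> measure (P \<epsilon>) C" .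
      have Cpos: "0 < measure (P \<epsilon>) C" using W W_le by linarith
      \<comment> \<open>The block index exceeds \<open>d / \<epsilon>\<close> by at most 1, so the
        weight is bounded below by a quantity of order \<epsilon> cubed.\<close>
      have "1 / (32 * zeta3 * (d / \<epsilon> + 1) ^ 3) \<le> 1 / (32 * zeta3 * real n ^ 3)"
        using n_le n1 z3 by (intro divide_left_mono mult_left_mono power_mono mult_pos_pos) (auto simp: dpos add_pos_pos)
      also have "\<dots> = weight n / 32" by (simp add: weight_def)
      also note W_le
      finally have "ln (1 / (32 * zeta3 * (d / \<epsilon> + 1) ^ 3)) \<le> ln (measure (P \<epsilon>) C)"
        using Cpos z3 dpos by (subst ln_le_cancel_iff) (auto simp: add_pos_pos)
      then have "\<epsilon> * ln (1 / (32 * zeta3 * (d / \<epsilon> + 1) ^ 3)) \<le> \<epsilon> * ln (measure (P \<epsilon>) C)"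
        using \<epsilon> by (intro mult_left_mono) auto
      with elim(1) have "- b / 2 \<le> \<epsilon> * ln (measure (P \<epsilon>) C)" by linarith
      then show ?case using Cpos by (simp add: elog_def)
    qed
  qed
  ultimately have "ereal (- b / 2) \<le> ereal (- b)" by (rule order_trans[rotated])
  then show False using pos by simp
qed

end
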